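(* Let $X \subseteq \mathcal A^{\mathbb Z}$ be a minimal subshift and let $\mu \in \mathcal M(X,S)$. Then $$\dim_{\mathbb Q} E(X,S) \leq \liminf_{n\to\infty} \big(p_X(n) - |\mathcal K_{n-1}|\big)+ 1.$$ In particular, if $X$ is generated by a unimodular primitive directive sequence, then $$\dim_{\mathbb Q} E(X,S) \leq |\mathcal A|-r+1,$$ where $r$ is the number of connected components of the extension graph $\Gamma_X(\varepsilon)$ of the empty word.
   Context: A subshift is a closed set $X\subseteq\mathcal A^{\mathbb Z}$ ($\mathcal A$ a finite alphabet) with $S(X)=X$, $S$ the shift map; it is minimal if every orbit is dense. $\mathcal L(X)$ is the set of finite words occurring in points of $X$, $\mathcal L_n(X)$ the set of those of length $n$, $p_X(n)=|\mathcal L_n(X)|$; every letter of $\mathcal A$ is assumed to occur in $\mathcal L(X)$. $\mathcal M(X,S)$ is the set of $S$-invariant Borel probability measures on $X$. $E(X,S)\subseteq\mathbb R$ is the additive group of continuous additive eigenvalues: real numbers $\alpha$ for which there is a continuous $g:X\to\mathbb R/\mathbb Z$ with $g(Sx)=g(x)+\alpha\pmod{\mathbb Z}$ for all $x\in X$. For $J\subseteq\mathbb R$, $\dim_{\mathbb Q}J$ is the dimension of the $\mathbb Q$-vector space spanned by $J$. For $w\in\mathcal L(X)$, the extension graph $\Gamma_X(w)$ is the bipartite undirected graph with left vertices $\{a_L: a\in\mathcal A,\ aw\in\mathcal L(X)\}$ and right vertices $\{b_R: b\in\mathcal A,\ wb\in\mathcal L(X)\}$ (disjoint copies), with an edge between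 $a_L$ and $b_R$ iff $awb\in\mathcal L(X)$. $\mathcal K_n$ is the disjoint union, over $u\in\mathcal L_n(X)$, of the sets of connected components of $\Gamma_X(u)$ (so $|\mathcal K_n|$ is the total number of these components). A directive sequence is a sequence $\boldsymbol\tau=(\tau_n:\mathcal A_{n+1}^*\to\mathcal A_n^* )_{n\ge0}$ of monoid morphisms between free monoids over finite alphabets (with at least two letters) with all $\tau_n(a)$ non-empty ($a\in\mathcal A_{n+1}$) and every letter of $\mathcal A_n$ occurring in some $\tau_n(a)$. With $\tau_{n,m}=\tau_n\circ\cdots\circ\tau_{m-1}$, it is primitive if for every $n$ there is $m>n$ such that every letter of $\mathcal A_n$ occurs in $\tau_{n,m}(a)$ for every $a\in\mathcal A_m$; it is unimodular if each incidence matrix (the $\mathcal A_n\times\mathcal A_{n+1}$ matrix whose $(b,a)$ entry is the number of occurrences of $b$ in $\tau_n(a)$) is square with determinant $\pm1$. It generates $X$ if $\mathcal A_0=\mathcal A$ and $X$ is the set of $x\in\mathcal A^{\mathbb Z}$ all of whose finite factors occur in some $\tau_{0,m}(a)$, $m\ge1$, $a\in\mathcal A_m$. *)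

theory Defs
  imports
    "HOL-Probability.Probability"
    "HOL-Library.Sublist"
    "Jordan_Normal_Form.Determinant"
begin

section \<open>The circle group \<open>\<real>/\<int>\<close>\<close>

quotient_type circle = real / "\<lambda>x y :: real. x - y \<in> \<int>"
  morphisms rep_circle circle_of
proof (rule equivpI)
  show "reflp (\<lambda>x y :: real. x - y \<in> \<int>)"
    by (simp add: reflp_def)
  show "symp (\<lambda>x y :: real. x - y \<in> \<int>)"
    by (metis (mono_tags, lifting) Ints_minus minus_diff_eq sympI)
  show "transp (\<lambda>x y :: real. x - y \<in> \<int>)"
    by (metis (mono_tags, lifting) Ints_add diff_add_cancel add_diff_eq transpI)
qed

instantiation circle :: ab_group_add
begin

lift_definition zero_circle :: circle is 0 .

lift_definition plus_circle :: "circle \<Rightarrow> circle \<Rightarrow> circle" is "(+)"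
  by (metis Ints_add add_diff_add)

lift_definition uminus_circle :: "circle \<Rightarrow> circle" is uminus
  by (metis Ints_minus minus_diff_minus)

lift_definition minus_circle :: "circle \<Rightarrow> circle \<Rightarrow> circle" is "(-)"
proof -
  fix a b c d :: real
  assume "a - b \<in> \<int>" "c - d \<in> \<int>"
  then have "(a - b) - (c - d) \<in> \<int>" by (rule Ints_diff)
  then show "(a - c) - (b - d) \<in> \<int>" by (simp add: algebra_simps)
qed

instance
  by standard (transfer; simp add: algebra_simps)+

end

text \<open>The quotient topology.\<close>

instantiation circle :: topological_space
begin

definition open_circle :: "circle set \<Rightarrow> bool" where
  "open_circle U \<longleftrightarrow> open (circle_of -` U)"

instance
  by standard (simp_all add: open_circle_def vimage_Union open_Int open_UN)

end


section \<open>Subshifts\<close>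

text \<open>
  Alphabets are finite sets of letters of a type with the discrete topology, so that
  \<^typ>\<open>int \<Rightarrow> 'a\<close> carries the product of discrete topologies and its Borel sets.
  Since the sequences over an alphabet \<open>A\<close> form a closed set, closedness in the full
  function space agrees with closedness in \<open>A\<^sup>\<int>\<close>.
\<close>

definition shift :: "(int \<Rightarrow> 'a) \<Rightarrow> int \<Rightarrow> 'a" where
  "shift x = (\<lambda>i. x (i + 1))"

definition orbit :: "(int \<Rightarrow> 'a) \<Rightarrow> (int \<Rightarrow> 'a) set" where
  "orbit x = range (\<lambda>k :: int. \<lambda>i. x (i + k))"

definition subshift :: "'a::discrete_topology set \<Rightarrow> (int \<Rightarrow> 'a) set \<Rightarrow> bool" where
  "subshift A X \<longleftrightarrow> closed X \<and> (\<forall>x\<in>X. range x \<subseteq> A) \<and> shift ` X = X"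

definition minimal_subshift :: "'a::discrete_topology set \<Rightarrow> (int \<Rightarrow> 'a) set \<Rightarrow> bool" where
  "minimal_subshift A X \<longleftrightarrow> subshift A X \<and> (\<forall>x\<in>X. X \<subseteq> closure (orbit x))"

definition factor :: "(int \<Rightarrow> 'a) \<Rightarrow> int \<Rightarrow> nat \<Rightarrow> 'a list" where
  "factor x i n = map (\<lambda>k. x (i + int k)) [0..<n]"

definition language :: "(int \<Rightarrow> 'a) set \<Rightarrow> 'a list set" where
  "language X = {factor x i n | x i n. x \<in> X}"

definition language_n :: "(int \<Rightarrow> 'a) set \<Rightarrow> nat \<Rightarrow> 'a list set" where
  "language_n X n = {w \<in> language X. length w = n}"

definition complexity :: "(int \<Rightarrow> 'a) set \<Rightarrow> nat \<Rightarrow> nat" where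
  "complexity X n = card (language_n X n)"

definition invariant_measures :: "(int \<Rightarrow> 'a::discrete_topology) set \<Rightarrow> (int \<Rightarrow> 'a) measure set" where
  "invariant_measures X =
     {M. sets M = sets (restrict_space borel X) \<and> prob_space M \<and> distr M M shift = M}"


section \<open>Continuous eigenvalues and rational dimension\<close>

definition eigenvalues :: "(int \<Rightarrow> 'a::discrete_topology) set \<Rightarrow> real set" where
  "eigenvalues X = {\<alpha>. \<exists>g :: (int \<Rightarrow> 'a) \<Rightarrow> circle. continuous_on X g \<and>
                         (\<forall>x\<in>X. g (shift x) = g x + circle_of \<alpha>)}"

abbreviation rat_scale :: "rat \<Rightarrow> real \<Rightarrow> real" where
  "rat_scale q x \<equiv> of_rat q * x"

lemma vector_space_rat_scale: "vector_space rat_scale"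
  by unfold_locales (simp_all add: of_rat_add of_rat_mult algebra_simps)

text \<open>
  The library dimension is a natural number that is \<open>0\<close> for infinite-dimensional spaces; here
  those get dimension \<open>\<infinity>\<close>.
\<close>

definition rat_dim :: "real set \<Rightarrow> enat" where
  "rat_dim J =
     (if \<exists>B. finite B \<and> J \<subseteq> module.span rat_scale B
      then enat (vector_space.dim rat_scale J) else \<infinity>)"


section \<open>Extension graphs\<close>

definition connected_components :: "'v set \<Rightarrow> ('v \<times> 'v) set \<Rightarrow> 'v set set" where
  "connected_components V E = V // {(u, v) \<in> V \<times> V. (u, v) \<in> (E \<union> E\<inverse>)\<^sup>*}"

definition ext_vertices :: "'a set \<Rightarrow> (int \<Rightarrow> 'a) set \<Rightarrow> 'a list \<Rightarrow> ('a + 'a) set" where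
  "ext_vertices A X w =
     Inl ` {a \<in> A. a # w \<in> language X} \<union> Inr ` {b \<in> A. w @ [b] \<in> language X}"

definition ext_edges :: "'a set \<Rightarrow> (int \<Rightarrow> 'a) set \<Rightarrow> 'a list \<Rightarrow> (('a + 'a) \<times> ('a + 'a)) set" where
  "ext_edges A X w = {(Inl a, Inr b) | a b. a \<in> A \<and> b \<in> A \<and> a # w @ [b] \<in> language X}"

definition ext_components :: "'a set \<Rightarrow> (int \<Rightarrow> 'a) set \<Rightarrow> 'a list \<Rightarrow> ('a + 'a) set set" where
  "ext_components A X w = connected_components (ext_vertices A X w) (ext_edges A X w)"

definition all_components ::
    "'a set \<Rightarrow> (int \<Rightarrow> 'a) set \<Rightarrow> nat \<Rightarrow> ('a list \<times> ('a + 'a) set) set" where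
  "all_components A X n = (SIGMA u : language_n X n. ext_components A X u)"


section \<open>Directive sequences\<close>

definition word_morphism :: "'b set \<Rightarrow> 'a set \<Rightarrow> ('b list \<Rightarrow> 'a list) \<Rightarrow> bool" where
  "word_morphism B A f \<longleftrightarrow> f ` lists B \<subseteq> lists A \<and> f [] = [] \<and>
     (\<forall>u\<in>lists B. \<forall>v\<in>lists B. f (u @ v) = f u @ f v)"

definition directive_sequence ::
    "(nat \<Rightarrow> 'a set) \<Rightarrow> (nat \<Rightarrow> 'a list \<Rightarrow> 'a list) \<Rightarrow> bool" where
  "directive_sequence \<A> \<tau> \<longleftrightarrow>
     (\<forall>n. finite (\<A> n) \<and> 2 \<le> card (\<A> n) \<and> word_morphism (\<A> (Suc n)) (\<A> n) (\<tau> n) \<and>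
          (\<forall>a\<in>\<A> (Suc n). \<tau> n [a] \<noteq> []) \<and>
          (\<forall>b\<in>\<A> n. \<exists>a\<in>\<A> (Suc n). b \<in> set (\<tau> n [a])))"

definition morphism_range ::
    "(nat \<Rightarrow> 'a list \<Rightarrow> 'a list) \<Rightarrow> nat \<Rightarrow> nat \<Rightarrow> 'a list \<Rightarrow> 'a list" where
  "morphism_range \<tau> n m = foldr (\<circ>) (map \<tau> [n..<m]) id"

definition primitive_sequence ::
    "(nat \<Rightarrow> 'a set) \<Rightarrow> (nat \<Rightarrow> 'a list \<Rightarrow> 'a list) \<Rightarrow> bool" where
  "primitive_sequence \<A> \<tau> \<longleftrightarrow>
     (\<forall>n. \<exists>m>n. \<forall>b\<in>\<A> n. \<forall>a\<in>\<A> m. b \<in> set (morphism_range \<tau> n m [a]))"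

text \<open>
  Rows and columns of the incidence matrix are numbered by enumerations \<open>e\<close> and \<open>e'\<close> of the
  two alphabets. The determinant up to sign does not depend on them.
\<close>

definition incidence_matrix ::
    "nat \<Rightarrow> (nat \<Rightarrow> 'a) \<Rightarrow> (nat \<Rightarrow> 'b) \<Rightarrow> ('b list \<Rightarrow> 'a list) \<Rightarrow> int mat" where
  "incidence_matrix d e e' f =
     Matrix.mat d d (\<lambda>(i, j). int (count_list (f [e' j]) (e i)))"

definition unimodular_morphism :: "'b set \<Rightarrow> 'a set \<Rightarrow> ('b list \<Rightarrow> 'a list) \<Rightarrow> bool" where
  "unimodular_morphism B A f \<longleftrightarrow> card A = card B \<and>
     (\<exists>e e'. bij_betw e {..<card A} A \<and> bij_betw e' {..<card B} B \<and>
             Determinant.det (incidence_matrix (card A) e e' f) \<in> {1, -1})"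

definition unimodular_sequence ::
    "(nat \<Rightarrow> 'a set) \<Rightarrow> (nat \<Rightarrow> 'a list \<Rightarrow> 'a list) \<Rightarrow> bool" where
  "unimodular_sequence \<A> \<tau> \<longleftrightarrow> (\<forall>n. unimodular_morphism (\<A> (Suc n)) (\<A> n) (\<tau> n))"

definition generates ::
    "(nat \<Rightarrow> 'a set) \<Rightarrow> (nat \<Rightarrow> 'a list \<Rightarrow> 'a list) \<Rightarrow> 'a set \<Rightarrow> (int \<Rightarrow> 'a) set \<Rightarrow> bool" where
  "generates \<A> \<tau> A X \<longleftrightarrow> \<A> 0 = A \<and>
     X = {x. range x \<subseteq> A \<and>
             (\<forall>i n. \<exists>m\<ge>1. \<exists>a\<in>\<A> m. sublist (factor x i n) (morphism_range \<tau> 0 m [a]))}"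

end

theory Submission
  imports Defs
begin

text \<open>
  Two independent facts carry the proof. Write \<open>\<mu>[w]\<close> for the measure of the cylinder
  of a word \<open>w\<close>.

  The first is an upper bound for the rational dimension of the span of the numbers
  \<open>\<mu>[w]\<close>, \<open>w\<close> of length \<open>n\<close>. Make the words of length \<open>n\<close> the edges of a graph whose
  vertices are the elements of \<open>\<K>\<^bsub>n-1\<^esub>\<close>: the edge \<open>w = u b\<close> starts in the component of
  \<open>b\<close> on the right of \<open>\<Gamma>(u)\<close>, and the same edge \<open>w = a u'\<close> ends in the component of \<open>a\<close>
  on the left of \<open>\<Gamma>(u')\<close>. If \<open>w\<close>, \<open>w'\<close> are consecutive windows of a point, they read \<open>a u\<close> and
  \<open>u b\<close> with \<open>a u b\<close> in the language, so \<open>w\<close> ends where \<open>w'\<close> starts. Hence every point is a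
  walk in this graph. By minimality the graph is connected, and by invariance of \<open>\<mu>\<close> the
  weights \<open>\<mu>[w]\<close> obey Kirchhoff's law at every vertex. A circulation on a connected graph is
  determined by its values off a spanning tree, so the span has dimension at most
  \<open>p(n) - |\<K>\<^bsub>n-1\<^esub>| + 1\<close>.

  The second is that every eigenvalue \<open>\<alpha>\<close> lies in such a span. An eigenfunction \<open>g\<close> is
  uniformly continuous, so a window of a point determines \<open>g\<close> up to a small error; with
  real lifts \<open>R\<close> of \<open>g\<close> taken near the values assigned to windows, the integer
  \<open>R(x) + \<alpha> - R(Sx)\<close> depends on a longer window only. Its Birkhoff sums differ from
  \<open>L \<alpha>\<close> by a bounded amount, so its integral is \<open>\<alpha>\<close>, and this integral is an integer
  combination of the \<open>\<mu>[w]\<close>. This holds for every sufficiently large \<open>n\<close>, which gives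
  the bound by the limit inferior.

  If \<open>X\<close> is generated by a unimodular primitive directive sequence, then already \<open>n = 1\<close>
  works. For a large level \<open>n\<close> the images of letters are long, so \<open>g\<close> at the start of the
  image of a letter \<open>a\<close> is nearly a function of \<open>a\<close>. There are always \<open>|A|\<close> letters, hence
  few nearly constant values, and these can be lifted to real numbers so that lifts close
  modulo \<open>\<int>\<close> are close. Then the integer \<open>k(a)\<close> counting how often \<open>g\<close> wraps around while
  passing the image of \<open>a\<close> does not depend on the letter that follows. Unimodularity moves
  the weights \<open>k\<close> on level \<open>n\<close> to integer weights \<open>K\<close> on \<open>A\<close>, and the sums of \<open>K\<close> along
  points again stay at bounded distance from \<open>L \<alpha>\<close>, because every window of a point is a
  concatenation of images of letters up to two short pieces.
\<close>

section \<open>Balanced weights on a connected graph\<close>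

text \<open>
  A circulation is determined by its values off a spanning tree. The induction contracts one
  edge \<open>e\<close> that is not a loop: Kirchhoff's law at the vertex \<open>v\<close> that disappears expresses
  the weight of \<open>e\<close> by the other weights, so \<open>e\<close> and \<open>v\<close> can be removed together. Balance is
  assumed for vertex sets \<open>U\<close> because this form passes to preimages under the contraction.
\<close>

lemma (in vector_space) span_balanced_weights:
  fixes s t :: "'e \<Rightarrow> 'v" and m :: "'e \<Rightarrow> 'b"
  assumes "finite E" "finite V" "s ` E \<subseteq> V" "t ` E \<subseteq> V"
    and "\<And>U. U \<subseteq> V \<Longrightarrow> U \<noteq> {} \<Longrightarrow> (\<forall>e\<in>E. s e \<in> U \<longleftrightarrow> t e \<in> U) \<Longrightarrow> U = V"
    and "\<And>U. sum m {e \<in> E. s e \<in> U} = sum m {e \<in> E. t e \<in> U}"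
  shows "\<exists>B\<subseteq>E. m ` E \<subseteq> span (m ` B) \<and> card B + card V \<le> card E + 1"
  using assms
proof (induction "card V" arbitrary: V E s t rule: less_induct)
  case less
  note fin = less.prems(1,2) and ends = less.prems(3,4)
    and conn = less.prems(5) and bal = less.prems(6)
  show ?case
  proof (cases "card V \<le> 1")
    case True
    then show ?thesis
      by (intro exI[of _ E]) (auto intro: span_base)
  next
    case False
    then obtain v where v: "v \<in> V" "{v} \<noteq> V"
      by (metis card.empty card_1_singleton_iff all_not_in_conv le_numeral_extra(4) zero_le_one One_nat_def)
    then obtain e where e: "e \<in> E" "(s e = v) \<noteq> (t e = v)"
      using conn[of "{v}"] by auto
    define w where "w = (if s e = v then t e else s e)"
    have w: "w \<in> V" "w \<noteq> v"
      using e ends by (auto simp: w_def split: if_splits)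
    define \<phi> where "\<phi> = (\<lambda>u. if u = v then w else u)"
    define E' where "E' = E - {e}"
    have fin': "finite E'" and E: "E = insert e E'" "e \<notin> E'"
      using fin e by (auto simp: E'_def)
    \<comment> \<open>A vertex set of the contracted graph pulls back to one that the contracted edge does not leave.\<close>
    have pre: "\<exists>U'. (\<forall>u. \<phi> u \<in> U \<longleftrightarrow> u \<in> U') \<and> (s e \<in> U' \<longleftrightarrow> t e \<in> U')" for U
      using e w by (intro exI[of _ "{u. \<phi> u \<in> U}"]) (auto simp: \<phi>_def w_def split: if_splits)
    have "\<exists>B\<subseteq>E'. m ` E' \<subseteq> span (m ` B) \<and> card B + card (V - {v}) \<le> card E' + 1"
    proof (rule less.hyps[of _ _ "\<phi> \<circ> s" "\<phi> \<circ> t"])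
      show "card (V - {v}) < card V"
        using v fin by (meson card_Diff1_less)
      show "finite (V - {v})" using fin by simp
      show "(\<phi> \<circ> s) ` E' \<subseteq> V - {v}" "(\<phi> \<circ> t) ` E' \<subseteq> V - {v}"
        using ends w by (auto simp: \<phi>_def E'_def)
      fix U
      show "sum m {e \<in> E'. (\<phi> \<circ> s) e \<in> U} = sum m {e \<in> E'. (\<phi> \<circ> t) e \<in> U}"
      proof -
        obtain U' where U': "\<And>u. \<phi> u \<in> U \<longleftrightarrow> u \<in> U'" "s e \<in> U' \<longleftrightarrow> t e \<in> U'"
          using pre by metis
        have *: "{x \<in> E. f x \<in> U'} = (if f e \<in> U' then insert e {x \<in> E'. f x \<in> U'} else {x \<in> E'. f x \<in> U'})" for f
          using E by auto
        have "sum m {x \<in> E. f x \<in> U'} = (if f e \<in> U' then m e else 0) + sum m {x \<in> E'. f x \<in> U'}" for f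
          using fin' E(2) by (simp add: *)
        then show ?thesis
          using bal[of U'] U' by (simp split: if_splits)
      qed
      assume U: "U \<subseteq> V - {v}" "U \<noteq> {}" "\<forall>e\<in>E'. (\<phi> \<circ> s) e \<in> U \<longleftrightarrow> (\<phi> \<circ> t) e \<in> U"
      obtain U' where U': "\<And>u. \<phi> u \<in> U \<longleftrightarrow> u \<in> U'" "s e \<in> U' \<longleftrightarrow> t e \<in> U'"
        using pre by metis
      have sub: "U \<subseteq> U'"
      proof
        fix u assume "u \<in> U"
        moreover have "\<phi> u = u" using \<open>u \<in> U\<close> U(1) by (auto simp: \<phi>_def)
        ultimately show "u \<in> U'" using U'(1)[of u] by simp
      qed
      have "U' \<inter> V = V"
        using U U' E sub ends by (intro conn) (auto simp: image_subset_iff)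
      moreover have "U' \<inter> V \<subseteq> insert v U"
      proof
        fix u assume "u \<in> U' \<inter> V"
        then show "u \<in> insert v U"
          using U'(1)[of u] by (simp add: \<phi>_def split: if_splits)
      qed
      ultimately show "U = V - {v}" using U(1) by auto
    qed (fact fin')
    then obtain B where B: "B \<subseteq> E'" "m ` E' \<subseteq> span (m ` B)"
        "card B + card (V - {v}) \<le> card E' + 1"
      by blast
    have "m e \<in> span (m ` E')"
    proof -
      define S where "S = sum m {x \<in> E'. s x = v}"
      define T where "T = sum m {x \<in> E'. t x = v}"
      have *: "{x \<in> E. f x = v} = (if f e = v then insert e {x \<in> E'. f x = v} else {x \<in> E'. f x = v})" for f
        using E by auto
      have "sum m {x \<in> E. f x = v} = (if f e = v then m e else 0) + sum m {x \<in> E'. f x = v}" for f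
        using fin' E(2) by (simp add: *)
      then have "m e = T - S \<or> m e = S - T"
        using bal[of "{v}"] e by (auto simp: S_def T_def algebra_simps split: if_splits)
      moreover have "S \<in> span (m ` E')" "T \<in> span (m ` E')"
        unfolding S_def T_def by (intro span_sum span_base; simp)+
      ultimately show ?thesis
        by (auto intro: span_diff)
    qed
    moreover have "span (m ` E') \<subseteq> span (m ` B)"
      using B(2) by (metis span_mono span_span)
    ultimately have "m ` E \<subseteq> span (m ` B)"
      using B(2) E by auto
    moreover have "card B + card V \<le> card E + 1"
      using B(3) E fin fin' v by (simp add: card_Diff_singleton)
    ultimately show ?thesis
      using B(1) E by blast
  qed
qed

section \<open>Rational dimension\<close>

interpretation rat: vector_space rat_scale
  by (rule vector_space_rat_scale)

text \<open>
  If the dimension is infinite, independent subsets of every finite size force the bound \<open>c\<close>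
  to be \<open>\<infinity>\<close>, so it suffices to bound the size of finite independent subsets in either case.
\<close>

lemma ereal_rat_dim_le:
  assumes "\<And>B. finite B \<Longrightarrow> B \<subseteq> J \<Longrightarrow> rat.independent B \<Longrightarrow> ereal (real (card B)) \<le> c"
  shows "ereal_of_enat (rat_dim J) \<le> c"
proof -
  obtain B where B: "B \<subseteq> J" "rat.independent B" "J \<subseteq> rat.span B"
    using rat.maximal_independent_subset[of J] by blast
  show ?thesis
  proof (cases "finite B")
    case True
    then have "rat_dim J = enat (card B)"
      using B rat.basis_card_eq_dim[of B J] by (auto simp: rat_dim_def)
    then show ?thesis
      using assms[of B] B True by simp
  next
    case False
    have "ereal (real n) \<le> c" for n
    proof -
      obtain C where "C \<subseteq> B" "finite C" "card C = n"
        using False infinite_arbitrarily_large by blast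
      then show ?thesis
        using assms[of C] B rat.independent_mono by auto
    qed
    then have "c = \<infinity>"
      by (metis ereal_less_eq(1) less_PInf_Ex_of_nat linorder_not_le ereal_infty_less_eq(1) )
    then show ?thesis by simp
  qed
qed

section \<open>Words and cylinders\<close>

lemma length_factor [simp]: "length (factor x i n) = n"
  by (simp add: factor_def)

lemma factor_nth [simp]: "k < n \<Longrightarrow> factor x i n ! k = x (i + int k)"
  by (simp add: factor_def)

lemma factor_eq_iff: "factor x i n = w \<longleftrightarrow> length w = n \<and> (\<forall>k<n. x (i + int k) = w ! k)"
  by (auto simp: list_eq_iff_nth_eq)

lemma factor_add: "factor x i (m + n) = factor x i m @ factor x (i + int m) n"
  by (auto simp: list_eq_iff_nth_eq nth_append algebra_simps of_nat_diff)

lemma factor_Suc: "factor x i (Suc n) = x i # factor x (i + 1) n"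
  using factor_add[of x i 1 n] by (simp add: factor_def)

lemma factor_Suc_snoc: "factor x i (Suc n) = factor x i n @ [x (i + int n)]"
  using factor_add[of x i n 1] by (simp add: factor_def)

lemma shift_funpow: "(shift ^^ k) x = (\<lambda>i. x (i + int k))"
  by (induction k) (auto simp: shift_def algebra_simps)

lemma factor_shift_funpow [simp]: "factor ((shift ^^ k) x) i n = factor x (i + int k) n"
  by (simp add: shift_funpow factor_def algebra_simps)

lemma factor_shift [simp]: "factor (shift x) i n = factor x (i + 1) n"
  using factor_shift_funpow[of 1 x] by simp

text \<open>
  Prescribing a window fixes finitely many coordinates with values in a discrete space.
\<close>

lemma open_factor: "open {x :: int \<Rightarrow> 'a::discrete_topology. factor x i n \<in> W}"
proof -
  have 1: "open {x :: int \<Rightarrow> 'a. x j = a}" for j a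
  proof -
    have "open ((\<lambda>x :: int \<Rightarrow> 'a. x j) -` {a})"
      by (intro open_vimage discrete_topology_class.open_discrete continuous_on_product_coordinates)
    then show ?thesis by (simp add: vimage_def)
  qed
  have "open {x :: int \<Rightarrow> 'a. factor x i n = w}" for w
  proof (cases "length w = n")
    case True
    then have "{x. factor x i n = w} = (\<Inter>k<n. {x. x (i + int k) = w ! k})"
      by (auto simp: factor_eq_iff)
    then show ?thesis using 1 by auto
  next
    case False
    then have "{x. factor x i n = w} = {}" by auto
    then show ?thesis by simp
  qed
  moreover have "{x. factor x i n \<in> W} = (\<Union>w\<in>W. {x. factor x i n = w})"
    by auto
  ultimately show ?thesis by auto
qed

locale measured_minimal_subshift =
  fixes A :: "'a::discrete_topology set"
    and X :: "(int \<Rightarrow> 'a) set"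
    and \<mu> :: "(int \<Rightarrow> 'a) measure"
  assumes finite_alphabet: "finite A"
    and minimal: "minimal_subshift A X"
    and invariant: "\<mu> \<in> invariant_measures X"
begin

lemma closed_X: "closed X" and range_subset: "x \<in> X \<Longrightarrow> x i \<in> A"
  and shift_image: "shift ` X = X"
  using minimal by (auto simp: minimal_subshift_def subshift_def)

sublocale prob_space \<mu>
  using invariant by (simp add: invariant_measures_def)

lemma sets_\<mu>: "sets \<mu> = sets (restrict_space borel X)"
  and distr_shift: "distr \<mu> \<mu> shift = \<mu>"
  using invariant by (simp_all add: invariant_measures_def)

lemma space_\<mu>: "space \<mu> = X"
  using sets_eq_imp_space_eq[OF sets_\<mu>] by (simp add: space_restrict_space)

lemma nonempty: "X \<noteq> {}"
  using not_empty by (simp add: space_\<mu>)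

lemma shift_funpow_in: "x \<in> X \<Longrightarrow> (shift ^^ k) x \<in> X"
  using shift_image by (induction k) auto

lemma shift_measurable: "shift \<in> \<mu> \<rightarrow>\<^sub>M \<mu>"
proof -
  have "continuous_on UNIV (shift :: (int \<Rightarrow> 'a) \<Rightarrow> _)"
    by (rule continuous_on_coordinatewise_then_product) (simp add: shift_def)
  then have "shift \<in> borel \<rightarrow>\<^sub>M (borel :: (int \<Rightarrow> 'a) measure)"
    by (rule borel_measurable_continuous_onI)
  then have "shift \<in> restrict_space borel X \<rightarrow>\<^sub>M restrict_space borel X"
    using shift_image
    by (intro measurable_restrict_space2 measurable_restrict_space1) (auto simp: space_restrict_space)
  then show ?thesis
    using measurable_cong_sets[OF sets_\<mu> sets_\<mu>] by blast
qed

lemma factor_sets [measurable]: "{x \<in> X. factor x i n \<in> W} \<in> sets \<mu>"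
  using open_factor[of i n W] by (auto simp: sets_\<mu> sets_restrict_space)

lemma language_n_subset: "language_n X n \<subseteq> {w. set w \<subseteq> A \<and> length w = n}"
  using range_subset by (auto simp: language_n_def language_def factor_def)

lemma finite_language_n: "finite (language_n X n)"
  using finite_lists_length_eq[OF finite_alphabet] language_n_subset by (rule finite_subset[rotated])

lemma factor_in_language: "x \<in> X \<Longrightarrow> factor x i n \<in> language_n X n"
  by (auto simp: language_n_def language_def)

definition cylinder_measure :: "'a list \<Rightarrow> real" where
  "cylinder_measure w = measure \<mu> {x \<in> X. factor x 0 (length w) = w}"

lemma measure_factor_shift: "measure \<mu> {x \<in> X. factor x (int k) n \<in> W} = measure \<mu> {x \<in> X. factor x 0 n \<in> W}"
proof (induction k)
  case (Suc k)
  have "measure \<mu> {x \<in> X. factor x (int k) n \<in> W}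
      = measure (distr \<mu> \<mu> shift) {x \<in> X. factor x (int k) n \<in> W}"
    by (simp add: distr_shift)
  also have "\<dots> = measure \<mu> (shift -` {x \<in> X. factor x (int k) n \<in> W} \<inter> X)"
    using measure_distr[OF shift_measurable factor_sets] by (simp add: space_\<mu>)
  also have "shift -` {x \<in> X. factor x (int k) n \<in> W} \<inter> X = {x \<in> X. factor x (int (Suc k)) n \<in> W}"
    using shift_image by (auto simp: add.commute)
  finally show ?case using Suc by simp
qed simp

lemma expectation_factor:
  fixes \<phi> :: "'a list \<Rightarrow> real"
  shows "integrable \<mu> (\<lambda>x. \<phi> (factor x (int k) n))"
    and "expectation (\<lambda>x. \<phi> (factor x (int k) n)) = (\<Sum>w\<in>language_n X n. \<phi> w * cylinder_measure w)"
proof -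
  define S where "S = (\<lambda>w. {x \<in> X. factor x (int k) n \<in> {w}})"
  have S: "S w \<in> sets \<mu>" for w
    unfolding S_def by (rule factor_sets)
  have eq: "\<phi> (factor x (int k) n) = (\<Sum>w\<in>language_n X n. \<phi> w * indicator (S w) x)" if "x \<in> space \<mu>" for x
  proof -
    have "(\<Sum>w\<in>language_n X n. \<phi> w * indicator (S w) x)
        = (\<Sum>w\<in>language_n X n. if w = factor x (int k) n then \<phi> w else 0)"
      using that by (intro sum.cong) (auto simp: S_def space_\<mu> indicator_def)
    then show ?thesis
      using finite_language_n factor_in_language that by (simp add: space_\<mu> sum.delta)
  qed
  have int: "integrable \<mu> (\<lambda>x. \<phi> w * indicator (S w) x)" for w
    using S[of w] by (intro integrable_mult_right integrable_real_indicator) (auto simp: emeasure_eq_measure)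
  show "integrable \<mu> (\<lambda>x. \<phi> (factor x (int k) n))"
    by (subst Bochner_Integration.integrable_cong[OF refl eq]) (auto intro: int)
  have "measure \<mu> (S w) = cylinder_measure w" if "w \<in> language_n X n" for w
    using that measure_factor_shift[of k n "{w}"] by (simp add: S_def cylinder_measure_def language_n_def)
  moreover have "expectation (indicator (S w)) = measure \<mu> (S w)" for w
    using S[of w] sets.sets_into_space[of "S w" \<mu>] by (simp add: Int_absorb2)
  moreover have "expectation (\<lambda>x. \<phi> (factor x (int k) n))
      = expectation (\<lambda>x. \<Sum>w\<in>language_n X n. \<phi> w * indicator (S w) x)"
    by (rule Bochner_Integration.integral_cong[OF refl eq])
  moreover have "\<dots> = (\<Sum>w\<in>language_n X n. expectation (\<lambda>x. \<phi> w * indicator (S w) x))"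
    by (rule Bochner_Integration.integral_sum) (rule int)
  ultimately show "expectation (\<lambda>x. \<phi> (factor x (int k) n)) = (\<Sum>w\<in>language_n X n. \<phi> w * cylinder_measure w)"
    by simp
qed

lemma measure_factor:
  "measure \<mu> {x \<in> X. factor x (int k) n \<in> W} = (\<Sum>w\<in>language_n X n \<inter> W. cylinder_measure w)"
proof -
  have "measure \<mu> {x \<in> X. factor x (int k) n \<in> W}
      = expectation (indicator {x \<in> X. factor x (int k) n \<in> W})"
    using factor_sets[of "int k" n W] sets.sets_into_space[OF factor_sets[of "int k" n W]] by (simp add: Int_absorb2)
  also have "\<dots> = expectation (\<lambda>x. indicator W (factor x (int k) n))"
    by (intro Bochner_Integration.integral_cong) (auto simp: space_\<mu> indicator_def)
  also have "\<dots> = (\<Sum>w\<in>language_n X n \<inter> W. cylinder_measure w)"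
    unfolding expectation_factor(2)
    by (simp add: indicator_def sum.If_cases finite_language_n if_distrib[of "\<lambda>c. c * _"] Int_def cong: if_cong)
  finally show ?thesis .
qed

text \<open>
  By invariance the mean of a Birkhoff sum of length \<open>L\<close> is \<open>L\<close> times the integral \<open>I\<close>, so
  \<open>L \<bar>I - \<alpha>\<bar> \<le> C\<close> for all \<open>L\<close>.
\<close>

lemma eq_expectation_if_bounded_discrepancy:
  fixes \<phi> :: "'a list \<Rightarrow> real"
  assumes "\<And>x L. x \<in> X \<Longrightarrow> \<bar>(\<Sum>k<L. \<phi> (factor x (int k) n)) - real L * \<alpha>\<bar> \<le> C"
  shows "\<alpha> = (\<Sum>w\<in>language_n X n. \<phi> w * cylinder_measure w)"
proof -
  define I where "I = (\<Sum>w\<in>language_n X n. \<phi> w * cylinder_measure w)"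
  have "real L * \<bar>I - \<alpha>\<bar> \<le> C" for L
  proof -
    let ?f = "\<lambda>x. (\<Sum>k<L. \<phi> (factor x (int k) n)) - real L * \<alpha>"
    have int: "integrable \<mu> ?f"
      by (auto intro!: Bochner_Integration.integrable_diff Bochner_Integration.integrable_sum expectation_factor)
    have "expectation ?f = real L * (I - \<alpha>)"
      by (subst Bochner_Integration.integral_diff)
         (auto simp: Bochner_Integration.integral_sum expectation_factor prob_space I_def algebra_simps)
    moreover have "\<bar>expectation ?f\<bar> \<le> expectation (\<lambda>x. \<bar>?f x\<bar>)"
      by (rule integral_abs_bound)
    moreover have "expectation (\<lambda>x. \<bar>?f x\<bar>) \<le> C"
      using integrable_abs[OF int] assms by (intro integral_le_const) (auto simp: space_\<mu>)
    ultimately show ?thesis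
      by (simp add: abs_mult)
  qed
  then have "\<bar>I - \<alpha>\<bar> = 0"
    by (metis abs_ge_zero linorder_not_le order_le_imp_less_or_eq reals_Archimedean3)
  then show ?thesis by (simp add: I_def)
qed

end

section \<open>The graph on the components of the extension graphs\<close>

text \<open>
  This is the form in which minimality enters: every point sees every word of the language.
\<close>

lemma (in measured_minimal_subshift) word_occurs:
  assumes "x \<in> X" "w \<in> language_n X n"
  shows "\<exists>i. factor x i n = w"
proof -
  obtain z i where z: "z \<in> X" "w = factor z i n"
    using assms(2) by (auto simp: language_n_def language_def)
  have "z \<in> closure (orbit x)"
    using minimal assms(1) z(1) by (auto simp: minimal_subshift_def)
  moreover have "z \<in> {y. factor y i n \<in> {w}}" using z by simp
  ultimately have "{y. factor y i n \<in> {w}} \<inter> orbit x \<noteq> {}"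
    using open_factor[of i n "{w}"] by (metis closure_iff_nhds_not_empty disjoint_iff order_refl)
  then obtain k where "factor (\<lambda>j. x (j + k)) i n = w"
    by (auto simp: orbit_def)
  then have "factor x (i + k) n = w"
    by (simp add: factor_def algebra_simps)
  then show ?thesis by blast
qed

text \<open>
  The component of the vertex \<open>p\<close> in \<open>\<Gamma>(u)\<close>, as a class of the relation whose quotient is the
  set of components.
\<close>

definition ext_component :: "'a set \<Rightarrow> (int \<Rightarrow> 'a) set \<Rightarrow> 'a list \<Rightarrow> 'a + 'a \<Rightarrow> ('a + 'a) set" where
  "ext_component A X u p =
     {(p, q) \<in> ext_vertices A X u \<times> ext_vertices A X u.
        (p, q) \<in> (ext_edges A X u \<union> (ext_edges A X u)\<inverse>)\<^sup>*} `` {p}"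

lemma ext_components_eq: "ext_components A X u = ext_component A X u ` ext_vertices A X u"
  by (auto simp: ext_components_def connected_components_def ext_component_def quotient_def)

lemma ext_component_eq_if_edge:
  assumes "p \<in> ext_vertices A X u" "q \<in> ext_vertices A X u" "(p, q) \<in> ext_edges A X u"
  shows "ext_component A X u p = ext_component A X u q"
proof -
  let ?r = "(ext_edges A X u \<union> (ext_edges A X u)\<inverse>)\<^sup>*"
  have "(p, q) \<in> ?r" "(q, p) \<in> ?r"
    using assms(3) by auto
  then show ?thesis
    using assms(1,2) by (auto simp: ext_component_def intro: rtrancl_trans)
qed

context measured_minimal_subshift
begin

text \<open>
  With \<open>w = u b = a u'\<close>, the edge \<open>w\<close> leads from the component of \<open>b\<close> on the right of
  \<open>\<Gamma>(u)\<close> to the component of \<open>a\<close> on the left of \<open>\<Gamma>(u')\<close>.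
\<close>

definition source :: "'a list \<Rightarrow> 'a list \<times> ('a + 'a) set" where
  "source w = (butlast w, ext_component A X (butlast w) (Inr (last w)))"

definition target :: "'a list \<Rightarrow> 'a list \<times> ('a + 'a) set" where
  "target w = (tl w, ext_component A X (tl w) (Inl (hd w)))"

lemma language_factors:
  assumes "u @ v @ w \<in> language X"
  shows "v \<in> language X" 
proof -
  obtain x i n where x: "x \<in> X" "u @ v @ w = factor x i n"
    using assms by (auto simp: language_def)
  have "v = factor x (i + int (length u)) (length v)"
  proof (rule nth_equalityI)
    fix k assume k: "k < length v"
    have "length u + k < n" using arg_cong[OF x(2), of length] k by simp
    moreover have "v ! k = (u @ v @ w) ! (length u + k)" using k by (simp add: nth_append)
    ultimately show "v ! k = factor x (i + int (length u)) (length v) ! k"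
      using k by (simp add: x(2) algebra_simps)
  qed simp
  then show ?thesis using x(1) by (auto simp: language_def)
qed

lemma Inl_in_ext_vertices: "Inl a \<in> ext_vertices A X u \<longleftrightarrow> a # u \<in> language X"
  and Inr_in_ext_vertices: "Inr a \<in> ext_vertices A X u \<longleftrightarrow> u @ [a] \<in> language X"
  using language_n_subset[of "Suc (length u)"] by (auto simp: ext_vertices_def language_n_def)

lemma all_components_eq:
  "all_components A X n = source ` language_n X (Suc n) \<union> target ` language_n X (Suc n)"
proof
  show "all_components A X n \<subseteq> source ` language_n X (Suc n) \<union> target ` language_n X (Suc n)"
  proof
    fix p assume "p \<in> all_components A X n"
    then obtain u v where p: "p = (u, ext_component A X u v)" "length u = n" "v \<in> ext_vertices A X u"
      by (auto simp: all_components_def ext_components_eq language_n_def)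
    show "p \<in> source ` language_n X (Suc n) \<union> target ` language_n X (Suc n)"
    proof (cases v)
      case (Inl a)
      then have "p = target (a # u)" "a # u \<in> language_n X (Suc n)"
        using p by (auto simp: target_def Inl_in_ext_vertices language_n_def)
      then show ?thesis by blast
    next
      case (Inr a)
      then have "p = source (u @ [a])" "u @ [a] \<in> language_n X (Suc n)"
        using p by (auto simp: source_def Inr_in_ext_vertices language_n_def)
      then show ?thesis by blast
    qed
  qed
  have "source w \<in> all_components A X n \<and> target w \<in> all_components A X n"
    if "w \<in> language_n X (Suc n)" for w
  proof -
    have w: "w \<in> language X" "length w = Suc n" using that by (auto simp: language_n_def)
    then have eq: "butlast w @ [last w] = w" "hd w # tl w = w"
      by (auto simp: neq_Nil_conv length_Suc_conv)
    have "tl w \<in> language X" "butlast w \<in> language X"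
      using language_factors[of "[hd w]" "tl w" "[]"] language_factors[of "[]" "butlast w" "[last w]"] eq w
      by auto
    then show ?thesis
      using w eq by (auto simp: all_components_def ext_components_eq source_def target_def
          language_n_def Inl_in_ext_vertices Inr_in_ext_vertices)
  qed
  then show "source ` language_n X (Suc n) \<union> target ` language_n X (Suc n) \<subseteq> all_components A X n"
    by blast
qed

text \<open>
  Consecutive windows read \<open>a u\<close> and \<open>u b\<close> with \<open>a u b\<close> in the language, and this word is the
  edge of \<open>\<Gamma>(u)\<close> that joins the two components.
\<close>

lemma target_eq_source:
  assumes "x \<in> X"
  shows "target (factor x i (Suc n)) = source (factor x (i + 1) (Suc n))"
proof -
  let ?u = "factor x (i + 1) n" and ?a = "x i" and ?b = "x (i + 1 + int n)"
  have w: "factor x i (Suc n) = ?a # ?u" "factor x (i + 1) (Suc n) = ?u @ [?b]"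
    by (rule factor_Suc, rule factor_Suc_snoc)
  have "factor x i (Suc (Suc n)) = ?a # ?u @ [?b]"
    by (metis factor_Suc w(2))
  then have aub: "?a # ?u @ [?b] \<in> language X"
    using assms unfolding language_def by (metis (mono_tags, lifting) mem_Collect_eq)
  moreover have "?a # ?u \<in> language X" "?u @ [?b] \<in> language X"
    using language_factors[of "[]" "?a # ?u" "[?b]"] language_factors[of "[?a]" "?u @ [?b]" "[]"] aub
    by auto
  ultimately have "ext_component A X ?u (Inl ?a) = ext_component A X ?u (Inr ?b)"
    by (intro ext_component_eq_if_edge)
       (auto simp: Inl_in_ext_vertices Inr_in_ext_vertices ext_edges_def range_subset[OF assms])
  then show ?thesis
    by (simp add: source_def target_def w)
qed

text \<open>
  Connectedness comes from the walk of a single point, which uses all edges. For Kirchhoff's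
  law, the points whose window at \<open>0\<close> ends in \<open>U\<close> are those whose window at \<open>1\<close> starts in
  \<open>U\<close>, and these have the same measure as those whose window at \<open>0\<close> starts in \<open>U\<close>.
\<close>

lemma cylinder_measures_spanning:
  "\<exists>B\<subseteq>language_n X (Suc n). cylinder_measure ` language_n X (Suc n) \<subseteq> rat.span (cylinder_measure ` B) \<and>
     card B + card (all_components A X n) \<le> complexity X (Suc n) + 1"
  unfolding complexity_def
proof (rule rat.span_balanced_weights)
  show "finite (language_n X (Suc n))" "finite (all_components A X n)"
    by (simp_all add: finite_language_n all_components_eq)
  show "source ` language_n X (Suc n) \<subseteq> all_components A X n"
    "target ` language_n X (Suc n) \<subseteq> all_components A X n"
    by (simp_all add: all_components_eq)
next
  fix U assume U: "U \<subseteq> all_components A X n" "U \<noteq> {}"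
    "\<forall>w\<in>language_n X (Suc n). (source w \<in> U) = (target w \<in> U)"
  obtain x where x: "x \<in> X" using nonempty by blast
  define P where "P = (\<lambda>i. source (factor x i (Suc n)) \<in> U)"
  have step: "P (i + 1) = P i" for i
    using U(3) factor_in_language[OF x, of i "Suc n"] target_eq_source[OF x, of i n] by (simp add: P_def)
  have const: "P i = P 0" for i
  proof (induction i rule: int_induct[where k = 0])
    case (step2 i)
    then show ?case using step[of "i - 1"] by simp
  qed (simp_all add: step)
  have "source w \<in> U \<longleftrightarrow> P 0" "target w \<in> U \<longleftrightarrow> P 0" if w: "w \<in> language_n X (Suc n)" for w
  proof -
    obtain i where "factor x i (Suc n) = w" using word_occurs[OF x w] by blast
    then show "source w \<in> U \<longleftrightarrow> P 0" using const[of i] by (simp add: P_def)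
    then show "target w \<in> U \<longleftrightarrow> P 0" using U(3) w by simp
  qed
  then show "U = all_components A X n"
    using U(1,2) unfolding all_components_eq by blast
next
  fix U :: "('a list \<times> ('a + 'a) set) set"
  have eq: "{w \<in> language_n X (Suc n). f w \<in> U} = language_n X (Suc n) \<inter> {w. f w \<in> U}" for f :: "'a list \<Rightarrow> _"
    by auto
  have "sum cylinder_measure {w \<in> language_n X (Suc n). target w \<in> U}
      = measure \<mu> {x \<in> X. factor x (int 0) (Suc n) \<in> {w. target w \<in> U}}"
    by (simp only: eq measure_factor)
  also have "\<dots> = measure \<mu> {x \<in> X. factor x (int 1) (Suc n) \<in> {w. source w \<in> U}}"
    using target_eq_source[of _ 0 n] by (intro arg_cong[where f = "measure \<mu>"]) auto
  also have "\<dots> = sum cylinder_measure {w \<in> language_n X (Suc n). source w \<in> U}"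
    by (simp only: eq measure_factor)
  finally show "sum cylinder_measure {w \<in> language_n X (Suc n). source w \<in> U}
      = sum cylinder_measure {w \<in> language_n X (Suc n). target w \<in> U}" ..
qed

lemma card_le_complexity_minus_components:
  assumes "rat.independent S" "S \<subseteq> rat.span (cylinder_measure ` language_n X (Suc n))"
  shows "card S + card (all_components A X n) \<le> complexity X (Suc n) + 1"
proof -
  obtain B where B: "B \<subseteq> language_n X (Suc n)"
      "cylinder_measure ` language_n X (Suc n) \<subseteq> rat.span (cylinder_measure ` B)"
      "card B + card (all_components A X n) \<le> complexity X (Suc n) + 1"
    using cylinder_measures_spanning by blast
  have fin: "finite B" using B(1) finite_language_n by (rule finite_subset)
  have "S \<subseteq> rat.span (cylinder_measure ` B)"
    using assms(2) rat.span_mono[OF B(2)] by (simp add: rat.span_span)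
  then have "card S \<le> card (cylinder_measure ` B)"
    using rat.independent_span_bound[of "cylinder_measure ` B" S] assms(1) fin by simp
  also have "\<dots> \<le> card B" using fin by (rule card_image_le)
  finally show ?thesis using B(3) by simp
qed

end

section \<open>Eigenfunctions are nearly determined by words\<close>

text \<open>
  A substitute for a metric on the circle: two points are close if their difference lies in
  \<open>small_arc e\<close>.
\<close>

definition small_arc :: "real \<Rightarrow> circle set" where
  "small_arc e = circle_of ` {-e<..<e}"

lemma circle_of_eq_iff: "circle_of r = circle_of s \<longleftrightarrow> r - s \<in> \<int>"
  by (rule circle.abs_eq_iff)

lemma circle_of_add: "circle_of (r + s) = circle_of r + circle_of s"
  by (simp add: plus_circle.abs_eq)

lemma circle_of_diff: "circle_of (r - s) = circle_of r - circle_of s"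
  by (simp add: minus_circle.abs_eq)

lemma circle_of_0: "circle_of 0 = 0"
  by (simp add: zero_circle_def)

lemma ex_circle_of: "\<exists>r. circle_of r = c \<and> 0 \<le> r \<and> r < 1"
proof -
  obtain r where "c = circle_of r" by (induction c rule: circle.abs_induct) auto
  then have "circle_of (frac r) = c"
    by (simp add: circle_of_eq_iff frac_def)
  then show ?thesis using frac_ge_0 frac_lt_1 by blast
qed

lemma arc_diff:
  assumes "c - b \<in> small_arc e" "d - b \<in> small_arc e'"
  shows "c - d \<in> small_arc (e + e')"
proof -
  obtain r s where rs: "c - b = circle_of r" "\<bar>r\<bar> < e" "d - b = circle_of s" "\<bar>s\<bar> < e'"
    using assms by (force simp: small_arc_def)
  then have "c - d = circle_of (r - s)"
    by (metis circle_of_diff diff_diff_eq2 diff_add_cancel)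
  moreover have "\<bar>r - s\<bar> < e + e'" using rs by linarith
  ultimately show ?thesis by (force simp: small_arc_def)
qed

lemma lift_if_arc:
  assumes "c - circle_of s \<in> small_arc e"
  obtains r where "circle_of r = c" "\<bar>r - s\<bar> < e"
proof -
  obtain t where "c - circle_of s = circle_of t" "\<bar>t\<bar> < e"
    using assms by (force simp: small_arc_def)
  then have "circle_of (s + t) = c" "\<bar>(s + t) - s\<bar> < e"
    by (simp_all add: circle_of_add) (metis add.commute diff_add_cancel)
  then show ?thesis using that by blast
qed

lemma open_arc: "open {c. c - d \<in> small_arc e}"
proof -
  obtain s where s: "circle_of s = d" using ex_circle_of by blast
  have "circle_of -` {c. c - d \<in> small_arc e} = (\<Union>k::int. {s + k - e<..<s + k + e})"
  proof (intro equalityI subsetI)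
    fix r assume "r \<in> circle_of -` {c. c - d \<in> small_arc e}"
    then obtain t where t: "circle_of (r - s) = circle_of t" "\<bar>t\<bar> < e"
      using s by (force simp: small_arc_def circle_of_diff)
    then obtain k :: int where "r - s - t = k"
      by (auto simp: circle_of_eq_iff Ints_def)
    with t(2) show "r \<in> (\<Union>k::int. {s + k - e<..<s + k + e})"
      by (intro UN_I[of k]) (auto simp: abs_less_iff)
  next
    fix r assume "r \<in> (\<Union>k::int. {s + k - e<..<s + k + e})"
    then obtain k :: int where "r \<in> {s + k - e<..<s + k + e}" by blast
    then have "r - s - k \<in> {-e<..<e}" by auto
    moreover have "circle_of (r - s - k) = circle_of r - d"
      by (simp add: s[symmetric] circle_of_eq_iff flip: circle_of_diff)
    ultimately show "r \<in> circle_of -` {c. c - d \<in> small_arc e}"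
      unfolding small_arc_def by (metis (mono_tags) image_eqI mem_Collect_eq vimageI2)
  qed
  then show ?thesis unfolding open_circle_def by auto
qed

lemma zero_in_arc: "0 < e \<Longrightarrow> 0 \<in> small_arc e"
  unfolding small_arc_def by (rule image_eqI[of _ _ 0]) (simp_all add: circle_of_0)

lemma take_factor [simp]: "m \<le> n \<Longrightarrow> take m (factor x i n) = factor x i m"
  by (auto simp: list_eq_iff_nth_eq)

lemma open_contains_cylinder:
  fixes x :: "int \<Rightarrow> 'a::discrete_topology"
  assumes "open V" "x \<in> V"
  shows "\<exists>N. \<forall>y. (\<forall>i\<in>{- int N..int N}. y i = x i) \<longrightarrow> y \<in> V"
proof -
  obtain U where U: "x \<in> (\<Pi>\<^sub>E i\<in>UNIV. U i)" "finite {i. U i \<noteq> UNIV}" "(\<Pi>\<^sub>E i\<in>UNIV. U i) \<subseteq> V"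
    using product_topology_open_contains_basis[of "\<lambda>_. euclidean" UNIV V x] assms
    by (auto simp: open_fun_def)
  define N where "N = nat (Max ((\<lambda>i. \<bar>i\<bar>) ` {i. U i \<noteq> UNIV}))"
  have N: "\<bar>i\<bar> \<le> int N" if "U i \<noteq> UNIV" for i
  proof -
    have "\<bar>i\<bar> \<le> Max ((\<lambda>i. \<bar>i\<bar>) ` {i. U i \<noteq> UNIV})"
      using that U(2) by (intro Max_ge) auto
    then show ?thesis unfolding N_def by linarith
  qed
  have "y \<in> V" if "\<forall>i\<in>{- int N..int N}. y i = x i" for y
  proof -
    have "y i \<in> U i" for i
    proof (cases "U i = UNIV")
      case False
      then have "y i = x i" using that N[of i] by (auto simp: abs_le_iff)
      then show ?thesis using U(1) by auto
    qed simp
    then show ?thesis using U(3) by auto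
  qed
  then show ?thesis by blast
qed

context measured_minimal_subshift
begin

lemma compact_X: "compact X"
proof -
  have "compactin (product_topology (\<lambda>_::int. euclidean) UNIV) (\<Pi>\<^sub>E i\<in>UNIV. A)"
    using finite_alphabet by (simp add: compactin_PiE finite_imp_compact)
  then have "compact (\<Pi>\<^sub>E i\<in>(UNIV :: int set). A)"
    by (simp add: euclidean_product_topology)
  moreover have "X \<subseteq> (\<Pi>\<^sub>E i\<in>UNIV. A)" using range_subset by auto
  ultimately show ?thesis
    using closed_X by (metis compact_Int_closed inf.absorb_iff2)
qed

lemma eigenfunction_shift_funpow:
  fixes g :: "(int \<Rightarrow> 'a) \<Rightarrow> circle"
  assumes "\<And>x. x \<in> X \<Longrightarrow> g (shift x) = g x + circle_of \<alpha>" "x \<in> X"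
  shows "g ((shift ^^ k) x) = g x + circle_of (real k * \<alpha>)"
proof (induction k)
  case 0
  show ?case by (simp add: circle_of_0)
next
  case (Suc k)
  then show ?case
    using assms(1)[OF shift_funpow_in[OF assms(2)], of k]
    by (simp add: distrib_right circle_of_add add.assoc add.commute)
qed

text \<open>
  Compactness gives a radius of uniform continuity for windows centred at the origin. Along an
  orbit \<open>g\<close> changes by multiples of \<open>\<alpha>\<close> that are the same for all points, so differences
  \<open>g x - g y\<close> do not change under the shift and the window may be moved to start at \<open>0\<close>.
\<close>

lemma eigenfunction_word_oscillation:
  fixes g :: "(int \<Rightarrow> 'a) \<Rightarrow> circle"
  assumes "continuous_on X g" "\<And>x. x \<in> X \<Longrightarrow> g (shift x) = g x + circle_of \<alpha>" "0 < e"
  obtains M where "\<And>x y. x \<in> X \<Longrightarrow> y \<in> X \<Longrightarrow> factor x 0 M = factor y 0 M \<Longrightarrow> g x - g y \<in> small_arc e"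
proof -
  define D where "D = (\<lambda>x N. {y :: int \<Rightarrow> 'a. \<forall>i\<in>{- int N..int N}. y i = x i})"
  have D_eq: "D x N = {y. factor y (- int N) (2 * N + 1) \<in> {factor x (- int N) (2 * N + 1)}}" for x N
  proof -
    have "(\<forall>i\<in>{- int N..int N}. y i = x i) \<longleftrightarrow> (\<forall>k<2 * N + 1. y (- int N + int k) = x (- int N + int k))" for y
    proof safe
      fix i assume *: "\<forall>k<2 * N + 1. y (- int N + int k) = x (- int N + int k)" "i \<in> {- int N..int N}"
      then show "y i = x i" using *(1)[rule_format, of "nat (i + int N)"] by auto
    qed auto
    then show ?thesis by (auto simp: D_def list_eq_iff_nth_eq)
  qed
  have "\<exists>N. \<forall>y\<in>X \<inter> D x N. g y - g x \<in> small_arc (e / 2)" if x: "x \<in> X" for x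
  proof -
    have "0 \<in> small_arc (e / 2)" using assms(3) by (simp add: zero_in_arc)
    then obtain V where V: "open V" "x \<in> V" "\<And>y. y \<in> X \<Longrightarrow> y \<in> V \<Longrightarrow> g y - g x \<in> small_arc (e / 2)"
      using assms(1)[unfolded continuous_on_topological, rule_format, OF x open_arc[of "g x" "e / 2"]]
      by auto
    then show ?thesis
      using open_contains_cylinder[OF V(1,2)] by (auto simp: D_def)
  qed
  then obtain N where N: "\<And>x y. x \<in> X \<Longrightarrow> y \<in> X \<Longrightarrow> y \<in> D x (N x) \<Longrightarrow> g y - g x \<in> small_arc (e / 2)"
    by (metis IntI)
  have "open (D x (N x))" for x
    unfolding D_eq by (rule open_factor)
  moreover have "X \<subseteq> (\<Union>x\<in>X. D x (N x))"
    by (auto simp: D_def)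
  ultimately obtain F where F: "F \<subseteq> X" "finite F" "X \<subseteq> (\<Union>x\<in>F. D x (N x))"
    using compactE_image[OF compact_X, of X "\<lambda>x. D x (N x)"] by blast
  define n where "n = Max (N ` F)"
  have "g x - g y \<in> small_arc e"
    if xy: "x \<in> X" "y \<in> X" "factor x 0 (2 * n + 1) = factor y 0 (2 * n + 1)" for x y
  proof -
    \<comment> \<open>Both points are moved so that their common word is centred at the origin.\<close>
    define x' y' where "x' = (shift ^^ n) x" and "y' = (shift ^^ n) y"
    have in_X: "x' \<in> X" "y' \<in> X"
      using xy by (simp_all add: x'_def y'_def shift_funpow_in)
    have "x' \<in> D y' n"
      using xy by (simp add: D_eq x'_def y'_def)
    obtain z where z: "z \<in> F" "y' \<in> D z (N z)" using F(3) in_X by blast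
    have "N z \<le> n" using F(2) z(1) by (auto simp: n_def)
    with \<open>x' \<in> D y' n\<close> z(2) have "x' \<in> D z (N z)"
      by (auto simp: D_def)
    then have "g x' - g y' \<in> small_arc (e / 2 + e / 2)"
      using N z F(1) in_X by (intro arc_diff[of _ "g z"]) auto
    moreover have "g x' - g y' = g x - g y"
      using eigenfunction_shift_funpow[of g, OF assms(2)] xy by (simp add: x'_def y'_def)
    ultimately show ?thesis by simp
  qed
  then show ?thesis using that by blast
qed

lemma eigenfunction_word_approximation:
  fixes g :: "(int \<Rightarrow> 'a) \<Rightarrow> circle"
  assumes "continuous_on X g" "\<And>x. x \<in> X \<Longrightarrow> g (shift x) = g x + circle_of \<alpha>" "0 < e"
  obtains c M where "\<And>w. 0 \<le> c w \<and> c w < 1"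
    "\<And>x. x \<in> X \<Longrightarrow> g x - circle_of (c (factor x 0 M)) \<in> small_arc e"
proof -
  obtain M where M: "\<And>x y. x \<in> X \<Longrightarrow> y \<in> X \<Longrightarrow> factor x 0 M = factor y 0 M \<Longrightarrow> g x - g y \<in> small_arc e"
    using eigenfunction_word_oscillation[OF assms] by blast
  define p where "p = (\<lambda>w. SOME x. x \<in> X \<and> factor x 0 M = w)"
  define c where "c = (\<lambda>w. SOME r. circle_of r = g (p w) \<and> 0 \<le> r \<and> r < 1)"
  have c: "circle_of (c w) = g (p w) \<and> 0 \<le> c w \<and> c w < 1" for w
    unfolding c_def by (rule someI_ex) (rule ex_circle_of)
  have p: "p (factor x 0 M) \<in> X \<and> factor (p (factor x 0 M)) 0 M = factor x 0 M" if "x \<in> X" for x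
    unfolding p_def by (rule someI[of _ x]) (simp add: that)
  show thesis
    using c p M by (intro that[of c M]) auto
qed

section \<open>Eigenvalues are combinations of cylinder measures\<close>

text \<open>
  The criterion by which eigenvalues are recognized as integrals of integer functions of a window.
\<close>

lemma in_span_if_bounded_discrepancy:
  fixes \<phi> :: "'a list \<Rightarrow> int"
  assumes "\<And>x L. x \<in> X \<Longrightarrow> \<bar>(\<Sum>k<L. real_of_int (\<phi> (factor x (int k) n))) - real L * \<alpha>\<bar> \<le> C"
  shows "\<alpha> \<in> rat.span (cylinder_measure ` language_n X n)"
proof -
  have "\<alpha> = (\<Sum>w\<in>language_n X n. real_of_int (\<phi> w) * cylinder_measure w)"
    using assms by (rule eq_expectation_if_bounded_discrepancy)
  also have "\<dots> = (\<Sum>w\<in>language_n X n. rat_scale (of_int (\<phi> w)) (cylinder_measure w))"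
    by simp
  also have "\<dots> \<in> rat.span (cylinder_measure ` language_n X n)"
    by (intro rat.span_sum rat.span_scale rat.span_base) auto
  finally show ?thesis .
qed

text \<open>
  With lifts \<open>R\<close> of \<open>g\<close> within \<open>1/8\<close> of the values \<open>c\<close> of windows, \<open>R(x) + \<alpha> - R(Sx)\<close> is
  an integer within \<open>1/4\<close> of an expression in two windows, hence it is obtained from that
  expression by rounding. Its Birkhoff sums telescope.
\<close>

lemma eigenvalue_in_span_cylinder_measures:
  assumes "\<alpha> \<in> eigenvalues X"
  obtains N where "\<And>n. N \<le> n \<Longrightarrow> \<alpha> \<in> rat.span (cylinder_measure ` language_n X n)"
proof -
  obtain g :: "(int \<Rightarrow> 'a) \<Rightarrow> circle" where g: "continuous_on X g" "\<And>x. x \<in> X \<Longrightarrow> g (shift x) = g x + circle_of \<alpha>"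
    using assms by (auto simp: eigenvalues_def)
  obtain c M where c: "\<And>w. 0 \<le> c w \<and> c w < 1"
      "\<And>x. x \<in> X \<Longrightarrow> g x - circle_of (c (factor x 0 M)) \<in> small_arc (1/8)"
    using eigenfunction_word_approximation[OF g, of "1/8"] by auto
  have "\<exists>r. circle_of r = g x \<and> \<bar>r - c (factor x 0 M)\<bar> < 1/8" if "x \<in> X" for x
    using lift_if_arc[OF c(2)[OF that]] by metis
  then obtain R where R: "\<And>x. x \<in> X \<Longrightarrow> circle_of (R x) = g x \<and> \<bar>R x - c (factor x 0 M)\<bar> < 1/8"
    by metis
  have "\<alpha> \<in> rat.span (cylinder_measure ` language_n X n)" if n: "Suc M \<le> n" for n
  proof -
    define \<phi> where "\<phi> = (\<lambda>w. round (\<alpha> + c (take M w) - c (take M (tl w))))"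
    have step: "real_of_int (\<phi> (factor x 0 n)) = R x + \<alpha> - R (shift x)" if x: "x \<in> X" for x
    proof -
      have sx: "shift x \<in> X" using shift_funpow_in[OF x, of 1] by simp
      have "circle_of (R x + \<alpha>) = circle_of (R (shift x))"
        using R[OF x] R[OF sx] g(2)[OF x] by (simp add: circle_of_add)
      then obtain m :: int where m: "R x + \<alpha> - R (shift x) = m"
        by (auto simp: circle_of_eq_iff Ints_def)
      have "take M (tl (factor x 0 n)) = factor (shift x) 0 M"
        using n by (cases n) (auto simp: factor_Suc)
      then have "\<phi> (factor x 0 n) = round (\<alpha> + c (factor x 0 M) - c (factor (shift x) 0 M))"
        using n by (simp add: \<phi>_def)
      also have "\<dots> = m"
        using R[OF x] R[OF sx] m by (intro round_unique') linarith
      finally show ?thesis using m by simp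
    qed
    have telescope: "(\<Sum>k<L. real_of_int (\<phi> (factor x (int k) n))) - real L * \<alpha> = R x - R ((shift ^^ L) x)"
      if x: "x \<in> X" for x L
    proof (induction L)
      case (Suc L)
      then show ?case
        using step[OF shift_funpow_in[OF x, of L]] by (simp add: algebra_simps)
    qed simp
    have bound: "\<bar>R x\<bar> \<le> 2" if "x \<in> X" for x
      using R[OF that] c(1)[of "factor x 0 M"] by linarith
    have "\<bar>(\<Sum>k<L. real_of_int (\<phi> (factor x (int k) n))) - real L * \<alpha>\<bar> \<le> 4"
      if "x \<in> X" for x L
      using telescope[OF that, of L] bound[OF that] bound[OF shift_funpow_in[OF that, of L]]
      by linarith
    then show ?thesis by (rule in_span_if_bounded_discrepancy)
  qed
  then show ?thesis using that by blast
qed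

end

section \<open>Unimodular directive sequences\<close>

lemma word_morphism_lists: "word_morphism B A f \<Longrightarrow> w \<in> lists B \<Longrightarrow> f w \<in> lists A"
  by (auto simp: word_morphism_def)

lemma word_morphism_append:
  "word_morphism B A f \<Longrightarrow> u \<in> lists B \<Longrightarrow> v \<in> lists B \<Longrightarrow> f (u @ v) = f u @ f v"
  by (auto simp: word_morphism_def)

lemma word_morphism_Nil: "word_morphism B A f \<Longrightarrow> f [] = []"
  by (simp add: word_morphism_def)

lemma word_morphism_Cons:
  assumes "word_morphism B A f" "a \<in> B" "w \<in> lists B"
  shows "f (a # w) = f [a] @ f w"
  using word_morphism_append[OF assms(1), of "[a]" w] assms(2,3) by simp

lemma word_morphism_compose:
  assumes "word_morphism C B g" "word_morphism B A f"
  shows "word_morphism C A (f \<circ> g)"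
proof -
  have "(f \<circ> g) ` lists C \<subseteq> lists A"
    using word_morphism_lists[OF assms(1)] word_morphism_lists[OF assms(2)] by fastforce
  then show ?thesis
    using word_morphism_lists[OF assms(1)] word_morphism_append[OF assms(1)] word_morphism_append[OF assms(2)]
    unfolding word_morphism_def[of C]
    by (simp add: word_morphism_Nil[OF assms(1)] word_morphism_Nil[OF assms(2)])
qed

lemma word_morphism_concat:
  assumes "word_morphism B A f" "w \<in> lists B"
  shows "f w = concat (map (\<lambda>a. f [a]) w)"
  using assms(2)
proof (induction w)
  case (Cons a w)
  then show ?case by (simp add: word_morphism_Cons[OF assms(1), of a w])
qed (simp add: word_morphism_Nil[OF assms(1)])

lemma morphism_range_refl [simp]: "morphism_range \<tau> n n = id"
  by (simp add: morphism_range_def)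

lemma morphism_range_split:
  assumes "n \<le> m" "m \<le> l"
  shows "morphism_range \<tau> n l = morphism_range \<tau> n m \<circ> morphism_range \<tau> m l"
proof -
  have fold: "foldr (\<circ>) fs h = foldr (\<circ>) fs id \<circ> h" for fs and h :: "'b \<Rightarrow> 'b"
    by (induction fs) (auto simp: comp_assoc)
  have "[n..<l] = [n..<m] @ [m..<l]"
    using assms upt_add_eq_append[of n m "l - m"] by simp
  then have "morphism_range \<tau> n l = foldr (\<circ>) (map \<tau> [n..<m]) (morphism_range \<tau> m l)"
    by (simp add: morphism_range_def)
  then show ?thesis
    by (simp only: fold[of _ "morphism_range \<tau> m l"]) (simp add: morphism_range_def)
qed

lemma morphism_range_Suc: "n \<le> m \<Longrightarrow> morphism_range \<tau> n (Suc m) = morphism_range \<tau> n m \<circ> \<tau> m"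
  using morphism_range_split[of n m "Suc m" \<tau>] by (simp add: morphism_range_def)

lemma sum_list_map_eq_sum_count_list:
  fixes K :: "'a \<Rightarrow> int"
  assumes "finite A" "w \<in> lists A"
  shows "sum_list (map K w) = (\<Sum>a\<in>A. int (count_list w a) * K a)"
  using assms(2)
proof (induction w)
  case (Cons b w)
  have "(\<Sum>a\<in>A. int (count_list (b # w) a) * K a)
      = (\<Sum>a\<in>A. int (count_list w a) * K a + (if a = b then K a else 0))"
    by (intro sum.cong) (auto simp: distrib_right)
  then show ?case
    using Cons assms(1) by (simp add: sum.distrib)
qed simp

text \<open>
  The weight of \<open>f(b)\<close> under \<open>K\<close> is the entry of the row vector \<open>K\<close> times the incidence matrix
  at \<open>b\<close>. Since the determinant \<open>\<delta>\<close> satisfies \<open>\<delta>\<^sup>2 = 1\<close>, the inverse matrix is \<open>\<delta>\<close> times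
  the adjugate and has integer entries.
\<close>

lemma unimodular_morphism_weights:
  assumes uni: "unimodular_morphism B A f" and mor: "word_morphism B A f"
  shows "\<exists>K :: 'a \<Rightarrow> int. \<forall>w\<in>lists B. sum_list (map K (f w)) = sum_list (map k w)"
proof -
  define d where "d = card A"
  obtain e e' where e: "bij_betw e {..<d} A" "bij_betw e' {..<d} B"
      and det: "Determinant.det (incidence_matrix d e e' f) \<in> {1, -1}" and AB: "card A = card B"
    using uni by (auto simp: unimodular_morphism_def d_def)
  define N where "N = incidence_matrix d e e' f"
  define \<delta> where "\<delta> = Determinant.det N"
  have N: "N \<in> carrier_mat d d" "\<And>i j. i < d \<Longrightarrow> j < d \<Longrightarrow> N $$ (i, j) = int (count_list (f [e' j]) (e i))"
    by (auto simp: N_def incidence_matrix_def)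
  have \<delta>: "\<delta> * \<delta> = 1" using det by (auto simp: \<delta>_def N_def)
  have adj: "(\<Sum>i<d. adj_mat N $$ (l, i) * N $$ (i, j)) = (if l = j then \<delta> else 0)" if "l < d" "j < d" for l j
  proof -
    have "(adj_mat N * N) $$ (l, j) = (\<delta> \<cdot>\<^sub>m 1\<^sub>m d) $$ (l, j)"
      using adj_mat(3)[OF N(1)] by (simp add: \<delta>_def)
    then show ?thesis
      using that N(1) adj_mat(1)[OF N(1)] by (simp add: scalar_prod_def atLeast0LessThan)
  qed
  define K where "K = (\<lambda>a. \<Sum>l<d. \<delta> * k (e' l) * adj_mat N $$ (l, the_inv_into {..<d} e a))"
  have K_e: "K (e i) = (\<Sum>l<d. \<delta> * k (e' l) * adj_mat N $$ (l, i))" if "i < d" for i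
    using that e(1) by (simp add: K_def bij_betw_def the_inv_into_f_f)
  have fin: "finite A" using e(1) bij_betw_finite by blast
  have "sum_list (map K (f [b])) = k b" if b: "b \<in> B" for b
  proof -
    obtain j where j: "j < d" "b = e' j"
      using b bij_betw_imp_surj_on[OF e(2)] by blast
    have "f [b] \<in> lists A"
      using word_morphism_lists[OF mor, of "[b]"] b by auto
    then have "sum_list (map K (f [b])) = (\<Sum>a\<in>A. int (count_list (f [b]) a) * K a)"
      by (rule sum_list_map_eq_sum_count_list[OF fin])
    also have "\<dots> = (\<Sum>i<d. int (count_list (f [b]) (e i)) * K (e i))"
      by (rule sum.reindex_bij_betw[OF e(1), symmetric])
    also have "\<dots> = (\<Sum>i<d. \<Sum>l<d. \<delta> * k (e' l) * (adj_mat N $$ (l, i) * N $$ (i, j)))"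
      using j by (intro sum.cong) (auto simp: K_e N(2) sum_distrib_left algebra_simps)
    also have "\<dots> = (\<Sum>l<d. \<delta> * k (e' l) * (\<Sum>i<d. adj_mat N $$ (l, i) * N $$ (i, j)))"
      by (subst sum.swap) (simp add: sum_distrib_left)
    also have "\<dots> = (\<Sum>l<d. if l = j then \<delta> * k (e' l) * \<delta> else 0)"
      using adj j by (intro sum.cong) auto
    also have "\<dots> = (\<delta> * \<delta>) * k (e' j)"
      using j by (simp add: mult_ac)
    finally show ?thesis using j \<delta> by simp
  qed
  then have "sum_list (map K (f w)) = sum_list (map k w)" if "w \<in> lists B" for w
    using that
  proof (induction w)
    case (Cons b w)
    then show ?case by (simp add: word_morphism_Cons[OF mor, of b w])
  qed (simp add: word_morphism_Nil[OF mor])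
  then show ?thesis by blast
qed

lemma prefix_concat_map:
  assumes "prefix u (concat (map F y))" "\<And>a. a \<in> set y \<Longrightarrow> length (F a) \<le> H"
  shows "\<exists>y' s. u = concat (map F y') @ s \<and> length s \<le> H \<and> set y' \<subseteq> set y"
  using assms
proof (induction y arbitrary: u)
  case (Cons a y)
  have "prefix u (F a) \<or> (\<exists>u'. u = F a @ u' \<and> prefix u' (concat (map F y)))"
    using Cons.prems(1) by (simp add: prefix_append)
  then show ?case
  proof
    assume "prefix u (F a)"
    then have "length u \<le> H" using Cons.prems(2)[of a] prefix_length_le by fastforce
    then show ?thesis by (intro exI[of _ "[]"] exI[of _ u]) simp
  next
    assume "\<exists>u'. u = F a @ u' \<and> prefix u' (concat (map F y))"
    then obtain u' where u': "u = F a @ u'" "prefix u' (concat (map F y))" by blast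
    obtain y' s where "u' = concat (map F y') @ s" "length s \<le> H" "set y' \<subseteq> set y"
      using Cons.IH[OF u'(2)] Cons.prems(2) by auto
    then show ?thesis
      using u'(1) by (intro exI[of _ "a # y'"] exI[of _ s]) auto
  qed
qed auto

text \<open>
  A word inside a concatenation of short blocks is itself a concatenation of blocks, up to two
  short pieces at its ends. Together with generation this desubstitutes the windows of a point.
\<close>

lemma sublist_concat_map:
  assumes "sublist u (concat (map F y))" "\<And>a. a \<in> set y \<Longrightarrow> length (F a) \<le> H"
  shows "\<exists>p y' s. u = p @ concat (map F y') @ s \<and> length p \<le> H \<and> length s \<le> H \<and> set y' \<subseteq> set y"
  using assms
proof (induction y arbitrary: u)
  case (Cons a y)
  have H: "length (F a) \<le> H" using Cons.prems(2) by simp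
  consider "sublist u (F a)" | "sublist u (concat (map F y))"
    | u1 u2 where "u = u1 @ u2" "suffix u1 (F a)" "prefix u2 (concat (map F y))"
    using Cons.prems(1) by (auto simp: sublist_append)
  then show ?case
  proof cases
    case 1
    then have "length u \<le> H" using H sublist_length_le by fastforce
    then show ?thesis by (intro exI[of _ u] exI[of _ "[]"]) simp
  next
    case 2
    then obtain p y' s where "u = p @ concat (map F y') @ s" "length p \<le> H" "length s \<le> H" "set y' \<subseteq> set y"
      using Cons.IH[of u] Cons.prems(2) by auto
    then show ?thesis
      by (intro exI[of _ p] exI[of _ y'] exI[of _ s]) auto
  next
    case 3
    then obtain y' s where "u2 = concat (map F y') @ s" "length s \<le> H" "set y' \<subseteq> set y"
      using prefix_concat_map[of u2 F y H] Cons.prems(2) by auto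
    moreover have "length u1 \<le> H" using 3(2) H suffix_length_le by fastforce
    ultimately show ?thesis
      using 3(1) by (intro exI[of _ u1] exI[of _ y'] exI[of _ s]) auto
  qed
qed auto

locale unimodular_directive_sequence =
  fixes \<A> :: "nat \<Rightarrow> 'a set" and \<tau> :: "nat \<Rightarrow> 'a list \<Rightarrow> 'a list"
  assumes directive: "directive_sequence \<A> \<tau>"
    and primitive: "primitive_sequence \<A> \<tau>"
    and unimodular: "unimodular_sequence \<A> \<tau>"
begin

lemma finite_level: "finite (\<A> n)" and two_letters: "2 \<le> card (\<A> n)"
  and step_morphism: "word_morphism (\<A> (Suc n)) (\<A> n) (\<tau> n)"
  and letter_occurs: "b \<in> \<A> n \<Longrightarrow> \<exists>a\<in>\<A> (Suc n). b \<in> set (\<tau> n [a])"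
  using directive by (auto simp: directive_sequence_def)

lemma card_level: "card (\<A> n) = card (\<A> 0)"
proof (induction n)
  case (Suc n)
  have "card (\<A> n) = card (\<A> (Suc n))"
    using unimodular unfolding unimodular_sequence_def unimodular_morphism_def by blast
  with Suc show ?case by simp
qed simp

lemma range_morphism: "n \<le> m \<Longrightarrow> word_morphism (\<A> m) (\<A> n) (morphism_range \<tau> n m)"
proof (induction m rule: dec_induct)
  case base
  show ?case by (simp add: word_morphism_def)
next
  case (step m)
  then show ?case
    using word_morphism_compose[OF step_morphism[of m]] by (simp only: morphism_range_Suc)
qed

lemma level_weights:
  "\<exists>K :: 'a \<Rightarrow> int. \<forall>w\<in>lists (\<A> n). sum_list (map K (morphism_range \<tau> 0 n w)) = sum_list (map k w)"
proof (induction n arbitrary: k)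
  case 0
  show ?case by auto
next
  case (Suc n)
  obtain k' :: "'a \<Rightarrow> int" where k': "\<And>w. w \<in> lists (\<A> (Suc n)) \<Longrightarrow> sum_list (map k' (\<tau> n w)) = sum_list (map k w)"
    using unimodular_morphism_weights[OF _ step_morphism] unimodular
    unfolding unimodular_sequence_def by metis
  obtain K :: "'a \<Rightarrow> int" where K: "\<And>w. w \<in> lists (\<A> n) \<Longrightarrow> sum_list (map K (morphism_range \<tau> 0 n w)) = sum_list (map k' w)"
    using Suc.IH by blast
  then show ?case
    using k' K word_morphism_lists[OF step_morphism]
    by (intro exI[of _ K]) (simp add: morphism_range_Suc)
qed

text \<open>
  Primitivity makes the image of each letter contain all letters of a lower alphabet, of
  which there are at least two, so passing to a higher level strictly increases the lengths.
\<close>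

lemma long_images: "\<exists>n. \<forall>a\<in>\<A> n. M < length (morphism_range \<tau> 0 n [a])"
proof (induction M)
  case 0
  show ?case by (intro exI[of _ 0]) simp
next
  case (Suc M)
  then obtain n where n: "\<And>a. a \<in> \<A> n \<Longrightarrow> M < length (morphism_range \<tau> 0 n [a])" by blast
  obtain m where m: "n < m" "\<And>a b. a \<in> \<A> m \<Longrightarrow> b \<in> \<A> n \<Longrightarrow> b \<in> set (morphism_range \<tau> n m [a])"
    using primitive unfolding primitive_sequence_def by metis
  have "Suc M < length (morphism_range \<tau> 0 m [a])" if a: "a \<in> \<A> m" for a
  proof -
    define w where "w = morphism_range \<tau> n m [a]"
    have w: "w \<in> lists (\<A> n)"
      using word_morphism_lists[OF range_morphism[of n m]] a m(1) by (simp add: w_def)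
    have "card (\<A> n) \<le> card (set w)"
      using m(2)[OF a] by (intro card_mono) (auto simp: w_def)
    then have "2 \<le> length w"
      using two_letters[of n] card_length[of w] by linarith
    then obtain b c v where bc: "w = b # c # v"
      by (metis One_nat_def Suc_1 Suc_le_length_iff)
    have "morphism_range \<tau> 0 m [a] = morphism_range \<tau> 0 n w"
      using morphism_range_split[of 0 n m \<tau>] m(1) by (simp add: w_def)
    also have "\<dots> = concat (map (\<lambda>a. morphism_range \<tau> 0 n [a]) w)"
      using w by (intro word_morphism_concat[OF range_morphism]) auto
    finally show ?thesis
      using n[of b] n[of c] w bc by simp
  qed
  then show ?case by blast
qed

text \<open>
  The level at which a word of the language appears is not controlled. As every letter occurs
  in the image of a letter of the next alphabet, the level can be raised.
\<close>

lemma sublist_deeper_image: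
  assumes "a \<in> \<A> m"
  shows "\<exists>b\<in>\<A> (m + k). sublist (morphism_range \<tau> 0 m [a]) (morphism_range \<tau> 0 (m + k) [b])"
proof (induction k)
  case 0
  then show ?case using assms by auto
next
  case (Suc k)
  then obtain b where b: "b \<in> \<A> (m + k)"
    "sublist (morphism_range \<tau> 0 m [a]) (morphism_range \<tau> 0 (m + k) [b])" by blast
  obtain c where c: "c \<in> \<A> (Suc (m + k))" "b \<in> set (\<tau> (m + k) [c])"
    using letter_occurs[OF b(1)] by blast
  then obtain u v where uv: "\<tau> (m + k) [c] = u @ [b] @ v"
    by (metis append_Cons append_Nil in_set_conv_decomp)
  have "u @ [b] @ v \<in> lists (\<A> (m + k))"
    using word_morphism_lists[OF step_morphism, of "[c]" "m + k"] c(1) uv by simp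
  then have "morphism_range \<tau> 0 (Suc (m + k)) [c]
      = morphism_range \<tau> 0 (m + k) u @ morphism_range \<tau> 0 (m + k) [b] @ morphism_range \<tau> 0 (m + k) v"
    using word_morphism_append[OF range_morphism[of 0 "m + k"]]
    by (simp add: morphism_range_Suc uv del: append_Cons)
  then have "sublist (morphism_range \<tau> 0 (m + k) [b]) (morphism_range \<tau> 0 (m + Suc k) [c])"
    by (auto simp: sublist_def)
  then show ?case
    using c(1) b(2) sublist_order.order_trans by fastforce
qed

lemma generated_factor:
  assumes "generates \<A> \<tau> A X" "x \<in> X"
  shows "\<exists>y\<in>lists (\<A> n). sublist (factor x i l) (morphism_range \<tau> 0 n y)"
proof -
  obtain m a where a: "a \<in> \<A> m" "sublist (factor x i l) (morphism_range \<tau> 0 m [a])"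
    using assms unfolding generates_def by blast
  obtain b where b: "b \<in> \<A> (m + n)" "sublist (factor x i l) (morphism_range \<tau> 0 (m + n) [b])"
    using sublist_deeper_image[OF a(1), of n] a(2) sublist_order.order_trans by blast
  have "morphism_range \<tau> 0 (m + n) [b] = morphism_range \<tau> 0 n (morphism_range \<tau> n (m + n) [b])"
    using morphism_range_split[of 0 n "m + n" \<tau>] by simp
  moreover have "morphism_range \<tau> n (m + n) [b] \<in> lists (\<A> n)"
    using b(1) by (intro word_morphism_lists[OF range_morphism]) auto
  ultimately show ?thesis using b(2) by metis
qed

end

section \<open>Lifting finitely many points of the circle\<close>

text \<open>
  The \<open>card B\<close> points \<open>c b\<close> miss one of \<open>card B + 1\<close> arcs of equal length. Cutting the circle
  at the end \<open>s\<close> of a missed arc, all lifts fall into an interval that is shorter than \<open>1\<close>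
  by the length of the arc, so no two of them are close modulo \<open>\<int>\<close> without being close.
\<close>

lemma separated_lifts:
  fixes c :: "'b \<Rightarrow> real"
  assumes "finite B"
  obtains C :: "'b \<Rightarrow> real" where "\<And>b. b \<in> B \<Longrightarrow> C b - c b \<in> \<int>"
    "\<And>a b (m::int). a \<in> B \<Longrightarrow> b \<in> B \<Longrightarrow> \<bar>C a - C b - m\<bar> < 1 / (card B + 1) \<Longrightarrow> m = 0"
proof -
  define d :: real where "d = card B + 1"
  have d: "d \<ge> 1" by (simp add: d_def)
  define f where "f = (\<lambda>b. nat \<lfloor>frac (c b) * d\<rfloor>)"
  have "card (f ` B) < card {..card B}"
    using card_image_le[OF assms, of f] by simp
  then obtain j where j: "j \<le> card B" "j \<notin> f ` B"
    by (metis atMost_iff card_mono assms finite_imageI linorder_not_le subsetI)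
  define s where "s = (real j + 1) / d"
  define C where "C = (\<lambda>b. s + frac (c b - s))"
  have separated: "m = 0" if ab: "a \<in> B" "b \<in> B" and m: "\<bar>C a - C b - m\<bar> < 1 / (card B + 1)" for a b and m :: int
  proof -
    have gap: "frac (c b - s) \<le> 1 - 1 / d" if "b \<in> B" for b
    proof (rule ccontr)
      assume *: "\<not> frac (c b - s) \<le> 1 - 1 / d"
      define \<theta> where "\<theta> = frac (c b - s) - (1 - 1 / d)"
      have \<theta>: "0 < \<theta>" "\<theta> < 1 / d"
        using * frac_lt_1[of "c b - s"] by (auto simp: \<theta>_def)
      have s: "s = j / d + 1 / d" by (simp add: s_def add_divide_distrib)
      have "j / d + 1 / d \<le> 1"
        using j(1) d by (simp add: d_def field_simps)
      moreover have "c b = \<lfloor>c b - s\<rfloor> + 1 + (j / d + \<theta>)"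
        by (simp add: \<theta>_def frac_def s)
      then have "c b - (j / d + \<theta>) = of_int (\<lfloor>c b - s\<rfloor> + 1)" by simp
      then have "c b - (j / d + \<theta>) \<in> \<int>" by (metis Ints_of_int)
      ultimately have "frac (c b) = j / d + \<theta>"
        using \<theta> d by (simp add: frac_unique_iff)
      then have "frac (c b) * d = j + \<theta> * d" using d by (simp add: field_simps)
      moreover have "0 \<le> \<theta> * d" "\<theta> * d < 1"
        using \<theta> d by (auto simp: field_simps)
      ultimately have "\<lfloor>frac (c b) * d\<rfloor> = int j"
        by (simp add: floor_eq_iff)
      then have "f b = j" by (simp add: f_def)
      then show False using j(2) that by blast
    qed
    have "\<bar>C a - C b\<bar> \<le> 1 - 1 / d"
      using gap[OF ab(1)] gap[OF ab(2)] frac_ge_0[of "c a - s"] frac_ge_0[of "c b - s"]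
      unfolding C_def by linarith
    then have "\<bar>real_of_int m\<bar> < 1" using m by (simp add: d_def)
    then show ?thesis by linarith
  qed
  show ?thesis
  proof (rule that[of C])
    show "C b - c b \<in> \<int>" for b
      by (simp add: C_def frac_def)
  qed (fact separated)
qed

section \<open>Eigenvalues of unimodular systems\<close>

text \<open>
  On a level with long images, \<open>g\<close> at the start of \<open>T[a]\<close> is within \<open>e\<close> of a value \<open>C a\<close>. If
  \<open>b\<close> and \<open>b'\<close> both follow \<open>a\<close>, then \<open>C b\<close> and \<open>C b'\<close> are within \<open>4 e\<close> modulo \<open>\<int>\<close>, because
  both are close to \<open>C a\<close> plus \<open>\<alpha>\<close> times the length of \<open>T[a]\<close>; the lifts are chosen so that they
  are then close as real numbers. Hence the wrapping number of \<open>a\<close> is an integer that does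
  not depend on the next letter. The error terms telescope exactly along a concatenation of
  images, so the discrepancy is bounded by a constant and does not grow with the number of blocks.
\<close>

lemma (in measured_minimal_subshift) eigenvalue_in_span_letters:
  assumes "\<alpha> \<in> eigenvalues X" "unimodular_directive_sequence \<A> \<tau>" "generates \<A> \<tau> A X"
  shows "\<alpha> \<in> rat.span (cylinder_measure ` language_n X 1)"
proof -
  interpret unimodular_directive_sequence \<A> \<tau> by (rule assms(2))
  have A0: "\<A> 0 = A" using assms(3) by (simp add: generates_def)
  \<comment> \<open>The number of letters is the same on all levels, so the tolerance can be fixed before the level.\<close>
  define e :: real where "e = 1 / (4 * (card A + 1))"
  have e: "0 < e" "4 * e = 1 / (card A + 1)" by (simp_all add: e_def divide_simps)
  obtain g :: "(int \<Rightarrow> 'a) \<Rightarrow> circle" where g: "continuous_on X g" "\<And>x. x \<in> X \<Longrightarrow> g (shift x) = g x + circle_of \<alpha>"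
    using assms(1) by (auto simp: eigenvalues_def)
  obtain c M where c: "\<And>x. x \<in> X \<Longrightarrow> g x - circle_of (c (factor x 0 M)) \<in> small_arc e"
    using eigenfunction_word_approximation[OF g e(1)] by metis
  obtain n where n: "\<And>a. a \<in> \<A> n \<Longrightarrow> M < length (morphism_range \<tau> 0 n [a])"
    using long_images by blast
  define T where "T = morphism_range \<tau> 0 n"
  have T: "word_morphism (\<A> n) A T"
    using range_morphism[of 0 n] by (simp add: T_def A0)
  obtain C :: "'a \<Rightarrow> real" where C: "\<And>a. a \<in> \<A> n \<Longrightarrow> C a - c (take M (T [a])) \<in> \<int>"
    "\<And>a b (m::int). a \<in> \<A> n \<Longrightarrow> b \<in> \<A> n \<Longrightarrow> \<bar>C a - C b - m\<bar> < 1 / (card A + 1) \<Longrightarrow> m = 0"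
    using separated_lifts[OF finite_level[of n], of "\<lambda>a. c (take M (T [a]))"] A0 card_level[of n] by metis
  define starts where "starts = (\<lambda>x w. x \<in> X \<and> factor x 0 (length w) = w)"
  define lift where "lift = (\<lambda>a x r. a \<in> \<A> n \<and> starts x (T [a]) \<and> circle_of r = g x \<and> \<bar>r - C a\<bar> < e)"
  have starts_append: "starts x u \<and> starts ((shift ^^ length u) x) v" if "starts x (u @ v)" for x u v
    using that shift_funpow_in by (auto simp: starts_def factor_add)
  have ex_lift: "\<exists>r. lift a x r" if "a \<in> \<A> n" "starts x (T [a])" for a x
  proof -
    have "factor x 0 M = take M (factor x 0 (length (T [a])))"
      using n[OF that(1)] by (simp add: T_def)
    also have "\<dots> = take M (T [a])" using that(2) by (simp add: starts_def)
    finally have "g x - circle_of (c (take M (T [a]))) \<in> small_arc e"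
      using c[of x] that(2) by (simp add: starts_def)
    moreover have "circle_of (c (take M (T [a]))) = circle_of (C a)"
      using C(1)[OF that(1)] Ints_minus by (fastforce simp: circle_of_eq_iff)
    ultimately show ?thesis
      using that lift_if_arc[of "g x" "C a" e] unfolding lift_def by metis
  qed
  \<comment> \<open>The integer by which the chosen lifts wrap around while passing the letter \<open>a\<close>.\<close>
  define wraps where "wraps = (\<lambda>a (m::int). \<exists>b x r s. lift a x r \<and> lift b ((shift ^^ length (T [a])) x) s \<and>
      m = r + \<alpha> * length (T [a]) - s)"
  define k where "k = (\<lambda>a. SOME m. wraps a m)"
  have wraps_unique: "m = m'" if m: "wraps a m" "wraps a m'" for a m m'
  proof -
    obtain b x r s b' x' r' s' where *: "lift a x r" "lift b ((shift ^^ length (T [a])) x) s"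
        "m = r + \<alpha> * length (T [a]) - s"
        "lift a x' r'" "lift b' ((shift ^^ length (T [a])) x') s'" "m' = r' + \<alpha> * length (T [a]) - s'"
      using m unfolding wraps_def by blast
    have "\<bar>r - C a\<bar> < e" "\<bar>r' - C a\<bar> < e" "\<bar>s - C b\<bar> < e" "\<bar>s' - C b'\<bar> < e" "b \<in> \<A> n" "b' \<in> \<A> n"
      using * by (auto simp: lift_def)
    moreover have "real_of_int (m - m') = (r - r') - (s - s')"
      using *(3,6) by simp
    ultimately have "\<bar>C b' - C b - real_of_int (m - m')\<bar> < 4 * e"
      by linarith
    then have "m - m' = 0" using C(2) \<open>b \<in> \<A> n\<close> \<open>b' \<in> \<A> n\<close> e(2) by metis
    then show ?thesis by simp
  qed
  have k: "k a = r + \<alpha> * length (T [a]) - s"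
    if "lift a x r" "lift b ((shift ^^ length (T [a])) x) s" for a b x r s
  proof -
    have "x \<in> X" using that(1) by (simp add: lift_def starts_def)
    then have "circle_of (r + \<alpha> * length (T [a])) = circle_of s"
      using that eigenfunction_shift_funpow[of g, OF g(2), of x "length (T [a])"]
      by (simp add: lift_def circle_of_add mult.commute)
    then obtain m :: int where "r + \<alpha> * length (T [a]) - s = m"
      by (auto simp: circle_of_eq_iff Ints_def)
    then have "wraps a m" using that unfolding wraps_def by metis
    then have "k a = m" using wraps_unique by (metis k_def someI)
    then show ?thesis using \<open>_ = real_of_int m\<close> by simp
  qed
  define Q where "Q = (\<Sum>a\<in>\<A> n. \<bar>k a\<bar> + \<bar>\<alpha>\<bar> * length (T [a]) + \<bar>C a\<bar> + e)"
  have blocks: "\<bar>sum_list (map k (a # ys)) - \<alpha> * length (T (a # ys)) - r\<bar> \<le> Q"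
    if "lift a x r" "ys \<in> lists (\<A> n)" "starts x (T (a # ys))" for a ys x r
    using that
  proof (induction ys arbitrary: a x r)
    case Nil
    then have "a \<in> \<A> n" "\<bar>r - C a\<bar> < e" by (auto simp: lift_def)
    then have "\<bar>k a\<bar> + \<bar>\<alpha>\<bar> * length (T [a]) + \<bar>C a\<bar> + e \<le> Q"
      unfolding Q_def using finite_level e(1) by (intro member_le_sum) auto
    moreover have "\<bar>\<alpha> * length (T [a])\<bar> = \<bar>\<alpha>\<bar> * length (T [a])" by (simp add: abs_mult)
    ultimately show ?case using \<open>\<bar>r - C a\<bar> < e\<close> by simp
  next
    case (Cons b ys)
    have ab: "a \<in> \<A> n" "b \<in> \<A> n" "ys \<in> lists (\<A> n)"
      using Cons.prems by (auto simp: lift_def)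
    have split: "T (a # b # ys) = T [a] @ T (b # ys)" "T (b # ys) = T [b] @ T ys"
      using word_morphism_Cons[OF T, of a "b # ys"] word_morphism_Cons[OF T, of b ys] ab by simp_all
    define x' where "x' = (shift ^^ length (T [a])) x"
    have x': "starts x' (T (b # ys))"
      using Cons.prems(3) starts_append split(1) by (simp add: x'_def)
    then have "starts x' (T [b])" using starts_append split(2) by metis
    then obtain s where s: "lift b x' s" using ex_lift ab(2) by blast
    have "k a = r + \<alpha> * length (T [a]) - s"
      using k Cons.prems(1) s by (simp add: x'_def)
    moreover have "\<bar>sum_list (map k (b # ys)) - \<alpha> * length (T (b # ys)) - s\<bar> \<le> Q"
      using Cons.IH s ab(3) x' by blast
    ultimately show ?case by (simp add: split(1) algebra_simps)
  qed
  have blocks': "\<bar>sum_list (map k y) - \<alpha> * length (T y)\<bar> \<le> 2 * Q"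
    if y: "y \<in> lists (\<A> n)" "starts x (T y)" for x y
  proof (cases y)
    case Nil
    have "0 \<le> Q" unfolding Q_def using e(1) by (intro sum_nonneg) auto
    then show ?thesis using Nil by (simp add: word_morphism_Nil[OF T])
  next
    case (Cons a ys)
    have a: "a \<in> \<A> n" "ys \<in> lists (\<A> n)" using y Cons by auto
    then have "starts x (T [a])"
      using y(2) starts_append Cons word_morphism_Cons[OF T] by metis
    then obtain r where r: "lift a x r" using ex_lift a by blast
    have "\<bar>k a\<bar> + \<bar>\<alpha>\<bar> * length (T [a]) + \<bar>C a\<bar> + e \<le> Q"
      unfolding Q_def using finite_level e(1) a(1) by (intro member_le_sum) auto
    moreover have "\<bar>r - C a\<bar> < e" using r by (simp add: lift_def)
    moreover have "0 \<le> \<bar>\<alpha>\<bar> * length (T [a])" by simp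
    ultimately have "\<bar>r\<bar> \<le> Q" by linarith
    moreover have "\<bar>sum_list (map k y) - \<alpha> * length (T y) - r\<bar> \<le> Q"
      using blocks r a(2) y(2) Cons by blast
    ultimately show ?thesis by linarith
  qed
  obtain K where K: "\<And>w. w \<in> lists (\<A> n) \<Longrightarrow> sum_list (map K (T w)) = sum_list (map k w)"
    using level_weights[of n k] by (auto simp: T_def)
  define H where "H = Max ((\<lambda>a. length (T [a])) ` \<A> n)"
  have H: "length (T [a]) \<le> H" if "a \<in> \<A> n" for a
    using that finite_level by (auto simp: H_def)
  define P where "P = (\<Sum>a\<in>A. \<bar>real_of_int (K a)\<bar>) + \<bar>\<alpha>\<bar>"
  have K_le: "\<bar>real_of_int (K a)\<bar> + \<bar>\<alpha>\<bar> \<le> P" if "a \<in> A" for a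
    using that finite_alphabet member_le_sum[of a A "\<lambda>a. \<bar>real_of_int (K a)\<bar>"] by (simp add: P_def)
  have P0: "0 \<le> P" by (auto simp: P_def intro!: add_nonneg_nonneg sum_nonneg)
  \<comment> \<open>The discrepancy of a word: it is additive, and bounded on short words and on those images under \<open>T\<close> that occur in \<open>X\<close>.\<close>
  define D where "D = (\<lambda>w. real_of_int (sum_list (map K w)) - \<alpha> * length w)"
  have D_append: "D (u @ v) = D u + D v" for u v
    by (simp add: D_def algebra_simps)
  have D_short: "\<bar>D w\<bar> \<le> H * P" if "w \<in> lists A" "length w \<le> H" for w
  proof -
    have "\<bar>D w\<bar> \<le> length w * P"
      using that(1)
    proof (induction w)
      case (Cons a w)
      have "D (a # w) = (K a - \<alpha>) + D w" by (simp add: D_def algebra_simps)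
      then show ?case using Cons K_le[of a] by (simp add: algebra_simps)
    qed (simp add: D_def)
    also have "\<dots> \<le> H * P" using that(2) P0 by (intro mult_right_mono) auto
    finally show ?thesis .
  qed
  have "\<bar>(\<Sum>i<L. real_of_int (K (hd (factor x (int i) 1)))) - real L * \<alpha>\<bar> \<le> 2 * (H * P) + 2 * Q"
    if x: "x \<in> X" for x L
  proof -
    obtain y where y: "y \<in> lists (\<A> n)" "sublist (factor x 0 L) (T y)"
      using generated_factor[OF assms(3) x] unfolding T_def by blast
    then have "sublist (factor x 0 L) (concat (map (\<lambda>a. T [a]) y))"
      using word_morphism_concat[OF T] by simp
    then obtain p y' s where *: "factor x 0 L = p @ concat (map (\<lambda>a. T [a]) y') @ s"
        "length p \<le> H" "length s \<le> H" "set y' \<subseteq> set y"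
      using sublist_concat_map[of "factor x 0 L" "\<lambda>a. T [a]" y H] H y(1) by blast
    have y': "y' \<in> lists (\<A> n)" using *(4) y(1) by auto
    then have eq: "factor x 0 L = p @ T y' @ s"
      using *(1) word_morphism_concat[OF T] by simp
    have "starts x (p @ T y' @ s)" using x by (simp add: starts_def flip: eq)
    then have "starts ((shift ^^ length p) x) (T y')" using starts_append by blast
    then have "\<bar>D (T y')\<bar> \<le> 2 * Q"
      using blocks'[OF y'] K[OF y'] by (simp add: D_def)
    moreover have "factor x 0 L \<in> lists A"
      using range_subset[OF x] by (auto simp: factor_def)
    then have "\<bar>D p\<bar> \<le> H * P" "\<bar>D s\<bar> \<le> H * P"
      using *(2,3) by (auto intro!: D_short simp: eq)
    moreover have "(\<Sum>i<L. real_of_int (K (hd (factor x (int i) 1)))) - real L * \<alpha> = D (factor x 0 L)"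
      by (simp add: D_def factor_def sum_list_sum_nth atLeast0LessThan comp_def)
    ultimately show ?thesis by (simp add: eq D_append)
  qed
  then show ?thesis
    by (rule in_span_if_bounded_discrepancy)
qed

section \<open>The dimension bounds\<close>

theorem proposition6p5:
  fixes A :: "'a::discrete_topology set"
    and X :: "(int \<Rightarrow> 'a) set"
    and \<mu> :: "(int \<Rightarrow> 'a) measure"
  assumes "finite A"
    and "minimal_subshift A X"
    and "\<forall>a\<in>A. [a] \<in> language X"
    and "\<mu> \<in> invariant_measures X"
  shows "ereal_of_enat (rat_dim (eigenvalues X))
           \<le> liminf (\<lambda>n. ereal (real (complexity X n) - real (card (all_components A X (n - 1))))) + 1
         \<and>
         (\<forall>\<A> \<tau>. directive_sequence \<A> \<tau> \<and> primitive_sequence \<A> \<tau> \<and> unimodular_sequence \<A> \<tau> \<and>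
                generates \<A> \<tau> A X \<longrightarrow>
            ereal_of_enat (rat_dim (eigenvalues X))
              \<le> ereal (real (card A) - real (card (ext_components A X [])) + 1))"
proof (intro conjI allI impI)
  interpret measured_minimal_subshift A X \<mu>
    using assms by unfold_locales
  show "ereal_of_enat (rat_dim (eigenvalues X))
      \<le> liminf (\<lambda>n. ereal (real (complexity X n) - real (card (all_components A X (n - 1))))) + 1"
  proof (rule ereal_rat_dim_le)
    fix B assume B: "finite B" "B \<subseteq> eigenvalues X" "rat.independent B"
    have "\<exists>N. \<forall>n\<ge>N. \<alpha> \<in> rat.span (cylinder_measure ` language_n X n)" if "\<alpha> \<in> B" for \<alpha>
      using eigenvalue_in_span_cylinder_measures that B(2) by blast
    then have "\<forall>\<^sub>F n in sequentially. \<forall>\<alpha>\<in>B. \<alpha> \<in> rat.span (cylinder_measure ` language_n X n)"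
      using B(1) by (intro eventually_ball_finite) (auto simp: eventually_sequentially)
    then have "\<forall>\<^sub>F n in sequentially. ereal (real (card B) - 1)
        \<le> ereal (real (complexity X n) - real (card (all_components A X (n - 1))))"
      using eventually_gt_at_top[of 0]
    proof eventually_elim
      case (elim n)
      then obtain m where m: "n = Suc m" using gr0_implies_Suc by blast
      then have "B \<subseteq> rat.span (cylinder_measure ` language_n X (Suc m))"
        using elim(1) by blast
      then have "card B + card (all_components A X m) \<le> complexity X (Suc m) + 1"
        by (rule card_le_complexity_minus_components[OF B(3)])
      then have "real (card B + card (all_components A X m)) \<le> real (complexity X (Suc m) + 1)"
        by (simp only: of_nat_le_iff)
      then show ?case by (simp add: m)
    qed
    then have "ereal (real (card B) - 1)
        \<le> liminf (\<lambda>n. ereal (real (complexity X n) - real (card (all_components A X (n - 1)))))"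
      by (rule Liminf_bounded)
    then have "ereal (real (card B) - 1) + 1
        \<le> liminf (\<lambda>n. ereal (real (complexity X n) - real (card (all_components A X (n - 1))))) + 1"
      by (rule add_right_mono)
    then show "ereal (real (card B))
        \<le> liminf (\<lambda>n. ereal (real (complexity X n) - real (card (all_components A X (n - 1))))) + 1"
      by (simp add: one_ereal_def)
  qed
  fix \<A> \<tau> assume gen: "directive_sequence \<A> \<tau> \<and> primitive_sequence \<A> \<tau> \<and> unimodular_sequence \<A> \<tau> \<and>
    generates \<A> \<tau> A X"
  then have uni: "unimodular_directive_sequence \<A> \<tau>"
    by unfold_locales auto
  have "language_n X (Suc 0) = (\<lambda>a. [a]) ` A"
    using assms(3) language_n_subset[of "Suc 0"]
    by (fastforce simp: language_n_def length_Suc_conv)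
  then have letters: "complexity X (Suc 0) = card A"
    by (simp add: complexity_def card_image inj_on_def)
  obtain x where "x \<in> X" using nonempty by blast
  then have "language_n X 0 = {[]}"
    using factor_in_language[of x 0 0] by (auto simp: language_n_def factor_def)
  then have "all_components A X 0 = {[]} \<times> ext_components A X []"
    by (auto simp: all_components_def)
  then have components: "card (all_components A X 0) = card (ext_components A X [])"
    by (simp add: card_cartesian_product_singleton)
  show "ereal_of_enat (rat_dim (eigenvalues X))
      \<le> ereal (real (card A) - real (card (ext_components A X [])) + 1)"
  proof (rule ereal_rat_dim_le)
    fix B assume B: "finite B" "B \<subseteq> eigenvalues X" "rat.independent B"
    then have "B \<subseteq> rat.span (cylinder_measure ` language_n X (Suc 0))"
      using eigenvalue_in_span_letters[OF _ uni] gen by auto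
    then have "card B + card (ext_components A X []) \<le> card A + 1"
      using card_le_complexity_minus_components[OF B(3), of 0] by (simp add: letters components)
    then have "real (card B + card (ext_components A X [])) \<le> real (card A + 1)"
      by (simp only: of_nat_le_iff)
    then show "ereal (real (card B)) \<le> ereal (real (card A) - real (card (ext_components A X [])) + 1)"
      by simp
  qed
qed

end
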